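(* Suppose that $M$ is RDD and $b=e_w$ for a given $w\in[n]$. Then there exists a deterministic algorithm that computes $\hat x$ with $|\hat x-t^{\top}x^{\ast}|\le\varepsilon\|t\|_1\|D_M^{-1}b\|_\infty$ with average time complexity $O(\mathrm{nnz}(M)/n\cdot L^3\varepsilon^{-1})=\widetilde O(\mathrm{nnz}(M)/n\cdot\gamma^{-3}\varepsilon^{-1})$, where the average is taken over all choices of $w\in[n]$.
   Context: Setting: $M\in\mathbb{R}^{n\times n}$, $b\in\operatorname{range}(M)$, $t\in\mathbb{R}^n$, $t\ne0$, nonzero entries of absolute value in $[1/\mathrm{poly}(n),\mathrm{poly}(n)]$. RDD: positive diagonal and $M(j,j)\ge\sum_{k\ne j}|M(j,k)|$ for all $j$. Write $M=D_M-A_M^{\top}$ ($D_M$ diagonal part, $A_M^{\top}$ zero diagonal); $x^{\ast}:=\frac12\sum_{\ell\ge0}(\frac12(I+D_M^{-1}A_M^{\top}))^{\ell}D_M^{-1}b$. $\mathrm{nnz}(M)$ is the number of nonzero entries of $M$. Access: diagonal of $M$ in $O(1)$; nonzero entries of rows/columns of $M$ in time linear in their number; entries of $b,t$ in $O(1)$. The algorithm is given $\varepsilon>0$ and $0<\gamma\le\gamma_{\max}(M)$, where $\gamma_{\max}(M)=\max_{p\in[1,\infty]}\big(1-\|\frac12(I+D_M^{-1/q}A_M^{\top}D_M^{-1/p})|_{\operatorname{range}(I-D_M^{-1/q}A_M^{\top}D_M^{-1/p})}\|_p\big)$, $q$ conjugate to $p$; $L=\Theta\big(\frac1\gamma\log(\frac{1}{\gamma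 E}d_{\max}(M)\|t\|_0\|D_M^{-1}t\|_\infty\|b\|_0\|D_M^{-1}b\|_\infty)\big)$ with $E$ the target accuracy and suitable bounds on quantities inside the log known. *)

theory Defs
  imports Complex_Main "HOL-Library.Extended_Real" "Jordan_Normal_Form.Matrix"
begin

section \<open>Matrices and norms\<close>

definition rdd :: "real mat \<Rightarrow> bool" where
  "rdd M \<longleftrightarrow> (\<forall>j<dim_row M. M $$ (j, j) > 0 \<and>
     M $$ (j, j) \<ge> (\<Sum>k\<in>{..<dim_col M} - {j}. \<bar>M $$ (j, k)\<bar>))"

definition nnz :: "real mat \<Rightarrow> nat" where
  "nnz M = card {(i, j). i < dim_row M \<and> j < dim_col M \<and> M $$ (i, j) \<noteq> 0}"

definition mat_range :: "real mat \<Rightarrow> real vec set" where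
  "mat_range A = {A *\<^sub>v y | y. y \<in> carrier_vec (dim_col A)}"

definition l0_norm :: "real vec \<Rightarrow> nat" where
  "l0_norm v = card {i. i < dim_vec v \<and> v $ i \<noteq> 0}"

definition l1_norm :: "real vec \<Rightarrow> real" where
  "l1_norm v = (\<Sum>i<dim_vec v. \<bar>v $ i\<bar>)"

text \<open>Only meaningful for vectors of positive dimension.\<close>

definition linf_norm :: "real vec \<Rightarrow> real" where
  "linf_norm v = Max ((\<lambda>i. \<bar>v $ i\<bar>) ` {..<dim_vec v})"

definition lp_norm :: "ereal \<Rightarrow> real vec \<Rightarrow> real" where
  "lp_norm p v = (if p = \<infinity> then linf_norm v
     else (\<Sum>i<dim_vec v. \<bar>v $ i\<bar> powr real_of_ereal p) powr (1 / real_of_ereal p))"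

definition op_norm_on :: "ereal \<Rightarrow> real mat \<Rightarrow> real vec set \<Rightarrow> real" where
  "op_norm_on p T S = Sup {lp_norm p (T *\<^sub>v v) | v. v \<in> S \<and> lp_norm p v \<le> 1}"

text \<open>\<open>D_pow M s\<close> is the power \<open>D\<^sup>s\<close> of the diagonal part \<open>D\<close> of \<open>M\<close>; it is used only for matrices with
  positive diagonal. \<open>AT_part M\<close> is the matrix with zero diagonal such that \<open>M = D - AT_part M\<close>.\<close>

definition D_pow :: "real mat \<Rightarrow> real \<Rightarrow> real mat" where
  "D_pow M s = mat_diag (dim_row M) (\<lambda>i. M $$ (i, i) powr s)"

definition AT_part :: "real mat \<Rightarrow> real mat" where
  "AT_part M = mat_diag (dim_row M) (\<lambda>i. M $$ (i, i)) - M"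

definition d_max :: "real mat \<Rightarrow> real" where
  "d_max M = Max ((\<lambda>i. M $$ (i, i)) ` {..<dim_row M})"

definition lazy :: "real mat \<Rightarrow> real mat" where
  "lazy N = (1 / 2) \<cdot>\<^sub>m (1\<^sub>m (dim_row N) + N)"

text \<open>The vector-valued series is taken entrywise.\<close>

definition x_star :: "real mat \<Rightarrow> real vec \<Rightarrow> real vec" where
  "x_star M b = Matrix.vec (dim_row M) (\<lambda>i.
     1 / 2 * (\<Sum>l. ((lazy (D_pow M (-1) * AT_part M) ^\<^sub>m l) *\<^sub>v (D_pow M (-1) *\<^sub>v b)) $ i))"

text \<open>In \<^typ>\<open>ereal\<close> we have \<open>1 / \<infinity> = 0\<close>, so the pairs \<open>(1, \<infinity>)\<close> and \<open>(\<infinity>, 1)\<close> are conjugate.\<close>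

definition conjugate_exponents :: "ereal \<Rightarrow> ereal \<Rightarrow> bool" where
  "conjugate_exponents p q \<longleftrightarrow> 1 \<le> p \<and> 1 \<le> q \<and> 1 / p + 1 / q = 1"

definition N_pq :: "ereal \<Rightarrow> ereal \<Rightarrow> real mat \<Rightarrow> real mat" where
  "N_pq p q M =
     D_pow M (- real_of_ereal (1 / q)) * AT_part M * D_pow M (- real_of_ereal (1 / p))"

definition gamma_max :: "real mat \<Rightarrow> real" where
  "gamma_max M = Sup {1 - op_norm_on p (lazy (N_pq p q M)) (mat_range (1\<^sub>m (dim_row M) - N_pq p q M))
     | p q. conjugate_exponents p q}"

section \<open>The parameter \<open>L\<close>\<close>

definition target_accuracy :: "real mat \<Rightarrow> real vec \<Rightarrow> real vec \<Rightarrow> real \<Rightarrow> real" where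
  "target_accuracy M b t \<epsilon> = \<epsilon> * l1_norm t * linf_norm (D_pow M (-1) *\<^sub>v b)"

definition log_argument :: "real mat \<Rightarrow> real vec \<Rightarrow> real vec \<Rightarrow> real \<Rightarrow> real \<Rightarrow> real" where
  "log_argument M b t \<gamma> E = 1 / (\<gamma> * E) * d_max M
     * real (l0_norm t) * linf_norm (D_pow M (-1) *\<^sub>v t)
     * real (l0_norm b) * linf_norm (D_pow M (-1) *\<^sub>v b)"

text \<open>The logarithm inside a \<open>\<Theta>\<close> is bounded below by \<open>1\<close>. With \<open>E = target_accuracy M b t \<epsilon>\<close> and \<open>\<gamma> \<le> 1\<close>
  the logarithm of \<open>log_argument\<close> is at least \<open>ln (1 / \<epsilon>)\<close>, so that the bound can only matter for
  \<open>\<epsilon> > exp (-1)\<close>.\<close>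

definition log1 :: "real \<Rightarrow> real" where
  "log1 x = max 1 (ln x)"

definition L_param :: "real mat \<Rightarrow> real vec \<Rightarrow> real vec \<Rightarrow> real \<Rightarrow> real \<Rightarrow> real" where
  "L_param M b t \<gamma> \<epsilon> = 1 / \<gamma> * log1 (log_argument M b t \<gamma> (target_accuracy M b t \<epsilon>))"

section \<open>A real RAM with matrix access\<close>

text \<open>Registers and arrays hold either natural numbers (indices, counters) or exact real numbers.
  There is no multiplication of integers and no rounding of reals. Expressions are part of
  the fixed program, so their evaluation takes a constant number of operations and is absorbed in
  the unit cost of a command.\<close>

datatype nexp =
    NConst nat
  | NReg nat
  | NArr nat nexp
  | NAdd nexp nexp
  | NSub nexp nexp

datatype rexp =
    RReg nat
  | RArr nat nexp
  | ROfNat nexp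
  | RAdd rexp rexp
  | RSub rexp rexp
  | RMul rexp rexp
  | RDiv rexp rexp
  | RLn rexp

datatype bexp =
    NLess nexp nexp
  | RLess rexp rexp
  | BNot bexp
  | BAnd bexp bexp

text \<open>\<open>LoadCol k a c j\<close> stores the number of nonzero entries of column \<open>j\<close> in the register \<open>k\<close>, their
  row indices in the array \<open>a\<close> and their values in the real array \<open>c\<close>; similarly \<open>LoadRow\<close>.\<close>

datatype com =
    Skip
  | NSet nat nexp
  | NStore nat nexp nexp
  | RSet nat rexp
  | RStore nat nexp rexp
  | LoadDiag nat nexp
  | LoadB nat nexp
  | LoadT nat nexp
  | LoadRow nat nat nat nexp
  | LoadCol nat nat nat nexp
  | Seq com com
  | Cond bexp com com
  | While bexp com

record state =
  nreg :: "nat \<Rightarrow> nat"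
  rreg :: "nat \<Rightarrow> real"
  narr :: "nat \<Rightarrow> nat \<Rightarrow> nat"
  rarr :: "nat \<Rightarrow> nat \<Rightarrow> real"

text \<open>The part of the input which is only accessible through the \<open>Load\<close> commands. The order in which
  the nonzero entries of a row or column are listed is arbitrary.\<close>

record access =
  acc_mat :: "real mat"
  acc_b :: "real vec"
  acc_t :: "real vec"
  acc_rows :: "nat \<Rightarrow> nat list"
  acc_cols :: "nat \<Rightarrow> nat list"

definition lists_nonzeros :: "real mat \<Rightarrow> (nat \<Rightarrow> nat list) \<Rightarrow> (nat \<Rightarrow> nat list) \<Rightarrow> bool" where
  "lists_nonzeros M rlist clist \<longleftrightarrow>
     (\<forall>i<dim_row M. distinct (rlist i) \<and> set (rlist i) = {j. j < dim_col M \<and> M $$ (i, j) \<noteq> 0}) \<and>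
     (\<forall>j<dim_col M. distinct (clist j) \<and> set (clist j) = {i. i < dim_row M \<and> M $$ (i, j) \<noteq> 0})"

primrec nval :: "nexp \<Rightarrow> state \<Rightarrow> nat" where
  "nval (NConst k) s = k"
| "nval (NReg x) s = nreg s x"
| "nval (NArr a e) s = narr s a (nval e s)"
| "nval (NAdd e f) s = nval e s + nval f s"
| "nval (NSub e f) s = nval e s - nval f s"

primrec rval :: "rexp \<Rightarrow> state \<Rightarrow> real" where
  "rval (RReg x) s = rreg s x"
| "rval (RArr a e) s = rarr s a (nval e s)"
| "rval (ROfNat e) s = real (nval e s)"
| "rval (RAdd e f) s = rval e s + rval f s"
| "rval (RSub e f) s = rval e s - rval f s"
| "rval (RMul e f) s = rval e s * rval f s"
| "rval (RDiv e f) s = rval e s / rval f s"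
| "rval (RLn e) s = ln (rval e s)"

primrec bval :: "bexp \<Rightarrow> state \<Rightarrow> bool" where
  "bval (NLess e f) s \<longleftrightarrow> nval e s < nval f s"
| "bval (RLess e f) s \<longleftrightarrow> rval e s < rval f s"
| "bval (BNot b) s \<longleftrightarrow> \<not> bval b s"
| "bval (BAnd b c) s \<longleftrightarrow> bval b s \<and> bval c s"

definition set_nreg :: "nat \<Rightarrow> nat \<Rightarrow> state \<Rightarrow> state" where
  "set_nreg x v s = s\<lparr>nreg := (nreg s)(x := v)\<rparr>"

definition set_rreg :: "nat \<Rightarrow> real \<Rightarrow> state \<Rightarrow> state" where
  "set_rreg x v s = s\<lparr>rreg := (rreg s)(x := v)\<rparr>"

definition set_narr :: "nat \<Rightarrow> nat \<Rightarrow> nat \<Rightarrow> state \<Rightarrow> state" where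
  "set_narr a i v s = s\<lparr>narr := (narr s)(a := (narr s a)(i := v))\<rparr>"

definition set_rarr :: "nat \<Rightarrow> nat \<Rightarrow> real \<Rightarrow> state \<Rightarrow> state" where
  "set_rarr a i v s = s\<lparr>rarr := (rarr s)(a := (rarr s a)(i := v))\<rparr>"

definition load_list :: "nat \<Rightarrow> nat \<Rightarrow> nat \<Rightarrow> nat list \<Rightarrow> (nat \<Rightarrow> real) \<Rightarrow> state \<Rightarrow> state" where
  "load_list k a c is f s = s\<lparr>
     nreg := (nreg s)(k := length is),
     narr := (narr s)(a := (\<lambda>l. if l < length is then is ! l else narr s a l)),
     rarr := (rarr s)(c := (\<lambda>l. if l < length is then f (is ! l) else rarr s c l))\<rparr>"

text \<open>\<open>exec A P s k s'\<close>: started in \<open>s\<close>, the program \<open>P\<close> halts in \<open>s'\<close> after time \<open>k\<close>.\<close>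

inductive exec :: "access \<Rightarrow> com \<Rightarrow> state \<Rightarrow> nat \<Rightarrow> state \<Rightarrow> bool" for A :: access where
  exec_Skip: "exec A Skip s 1 s"
| exec_NSet: "exec A (NSet x e) s 1 (set_nreg x (nval e s) s)"
| exec_NStore: "exec A (NStore a i e) s 1 (set_narr a (nval i s) (nval e s) s)"
| exec_RSet: "exec A (RSet x e) s 1 (set_rreg x (rval e s) s)"
| exec_RStore: "exec A (RStore a i e) s 1 (set_rarr a (nval i s) (rval e s) s)"
| exec_LoadDiag: "nval i s < dim_row (acc_mat A) \<Longrightarrow>
    exec A (LoadDiag x i) s 1 (set_rreg x (acc_mat A $$ (nval i s, nval i s)) s)"
| exec_LoadB: "nval i s < dim_vec (acc_b A) \<Longrightarrow>
    exec A (LoadB x i) s 1 (set_rreg x (acc_b A $ nval i s) s)"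
| exec_LoadT: "nval i s < dim_vec (acc_t A) \<Longrightarrow>
    exec A (LoadT x i) s 1 (set_rreg x (acc_t A $ nval i s) s)"
| exec_LoadRow: "nval i s < dim_row (acc_mat A) \<Longrightarrow> js = acc_rows A (nval i s) \<Longrightarrow>
    exec A (LoadRow k a c i) s (1 + length js)
      (load_list k a c js (\<lambda>j. acc_mat A $$ (nval i s, j)) s)"
| exec_LoadCol: "nval j s < dim_col (acc_mat A) \<Longrightarrow> is = acc_cols A (nval j s) \<Longrightarrow>
    exec A (LoadCol k a c j) s (1 + length is)
      (load_list k a c is (\<lambda>i. acc_mat A $$ (i, nval j s)) s)"
| exec_Seq: "exec A P s k s' \<Longrightarrow> exec A Q s' l s'' \<Longrightarrow> exec A (Seq P Q) s (k + l) s''"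
| exec_CondT: "bval b s \<Longrightarrow> exec A P s k s' \<Longrightarrow> exec A (Cond b P Q) s (1 + k) s'"
| exec_CondF: "\<not> bval b s \<Longrightarrow> exec A Q s k s' \<Longrightarrow> exec A (Cond b P Q) s (1 + k) s'"
| exec_WhileF: "\<not> bval b s \<Longrightarrow> exec A (While b P) s 1 s"
| exec_WhileT: "bval b s \<Longrightarrow> exec A P s k s' \<Longrightarrow> exec A (While b P) s' l s'' \<Longrightarrow>
    exec A (While b P) s (1 + k + l) s''"

inductive_cases exec_basicE:
  "exec A Skip s k s'" "exec A (NSet x e) s k s'" "exec A (NStore a i e) s k s'"
  "exec A (RSet x e) s k s'" "exec A (RStore a i e) s k s'" "exec A (LoadDiag x i) s k s'"
  "exec A (LoadB x i) s k s'" "exec A (LoadT x i) s k s'" "exec A (LoadRow n a c i) s k s'"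
  "exec A (LoadCol n a c i) s k s'"
inductive_cases exec_SeqE: "exec A (Seq P Q) s k s'"
inductive_cases exec_CondE: "exec A (Cond b P Q) s k s'"
inductive_cases exec_WhileE: "exec A (While b P) s k s'"

lemma exec_deterministic:
  "exec A P s k s' \<Longrightarrow> exec A P s l s'' \<Longrightarrow> k = l \<and> s' = s''"
proof (induction arbitrary: l s'' rule: exec.induct)
  case (exec_Seq P s k s' Q m s2)
  from exec_Seq.prems show ?case
  proof (rule exec_SeqE)
    fix k' u m' assume *: "l = k' + m'" "exec A P s k' u" "exec A Q u m' s''"
    from exec_Seq.IH(1)[OF *(2)] have "k = k'" "s' = u" by simp_all
    with exec_Seq.IH(2)[of m' s''] * show ?thesis by simp
  qed
next
  case (exec_CondT b s P k s' Q)
  from exec_CondT.prems show ?case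
    by (rule exec_CondE) (use exec_CondT.hyps in \<open>auto dest: exec_CondT.IH\<close>)
next
  case (exec_CondF b s Q k s' P)
  from exec_CondF.prems show ?case
    by (rule exec_CondE) (use exec_CondF.hyps in \<open>auto dest: exec_CondF.IH\<close>)
next
  case (exec_WhileF b s P)
  from exec_WhileF.prems show ?case
    by (rule exec_WhileE) (use exec_WhileF.hyps in simp_all)
next
  case (exec_WhileT b s P k s' m s2)
  from exec_WhileT.prems show ?case
  proof (rule exec_WhileE)
    assume "\<not> bval b s"
    with exec_WhileT.hyps show ?thesis by simp
  next
    fix k' u m' assume *: "l = Suc (k' + m')" "exec A P s k' u" "exec A (While b P) u m' s''"
    from exec_WhileT.IH(1)[OF *(2)] have "k = k'" "s' = u" by simp_all
    with exec_WhileT.IH(2)[of m' s''] * show ?thesis by simp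
  qed
qed (erule exec_basicE, simp)+

text \<open>The numbers \<open>n\<close>, \<open>w\<close>, \<open>\<epsilon>\<close>, \<open>\<gamma>\<close> and \<open>\<Lambda>\<close> are given in registers; all other memory is initially \<open>0\<close>.
  The result is returned in the real register \<open>0\<close>.\<close>

definition input_state :: "nat \<Rightarrow> nat \<Rightarrow> real \<Rightarrow> real \<Rightarrow> real \<Rightarrow> state" where
  "input_state n w \<epsilon> \<gamma> \<Lambda> = \<lparr>
     nreg = (\<lambda>_. 0)(0 := n, 1 := w),
     rreg = (\<lambda>_. 0)(0 := \<epsilon>, 1 := \<gamma>, 2 := \<Lambda>),
     narr = (\<lambda>_ _. 0),
     rarr = (\<lambda>_ _. 0)\<rparr>"

definition computes :: "com \<Rightarrow> access \<Rightarrow> state \<Rightarrow> nat \<Rightarrow> real \<Rightarrow> bool" where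
  "computes P A s k y \<longleftrightarrow> (\<exists>s'. exec A P s k s' \<and> rreg s' 0 = y)"

section \<open>Hypotheses on the input\<close>

definition poly_entries :: "real \<Rightarrow> nat \<Rightarrow> nat \<Rightarrow> real set \<Rightarrow> bool" where
  "poly_entries c a n X \<longleftrightarrow>
     (\<forall>x\<in>X. x \<noteq> 0 \<longrightarrow> 1 / (c * real n ^ a) \<le> \<bar>x\<bar> \<and> \<bar>x\<bar> \<le> c * real n ^ a)"

text \<open>\<open>\<Lambda>\<close> is a known upper bound of the argument of the logarithm in \<open>L\<close>, which is suitable in the sense
  that using it instead of the argument changes \<open>L\<close> by at most the constant factor \<open>\<kappa>\<close>.\<close>

definition suitable_bound :: "real \<Rightarrow> real mat \<Rightarrow> real vec \<Rightarrow> real vec \<Rightarrow> real \<Rightarrow> real \<Rightarrow> real \<Rightarrow> bool" where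
  "suitable_bound \<kappa> M b t \<gamma> \<epsilon> \<Lambda> \<longleftrightarrow>
     (let X = log_argument M b t \<gamma> (target_accuracy M b t \<epsilon>) in X \<le> \<Lambda> \<and> log1 \<Lambda> \<le> \<kappa> * log1 X)"

text \<open>For \<open>b = e\<^sub>w\<close> the two factors depending on \<open>w\<close> cancel in \<open>L\<close>.\<close>

lemma D_inv_unit_vec_linf_pos:
  assumes "M \<in> carrier_mat n n" "rdd M" "w < n"
  shows "linf_norm (D_pow M (-1) *\<^sub>v unit_vec n w) > 0"
proof -
  let ?v = "D_pow M (-1) *\<^sub>v unit_vec n w"
  have v: "dim_vec ?v = n" "?v $ w = M $$ (w, w) powr (-1)"
    using assms by (auto simp: D_pow_def mat_diag_def)
  have "M $$ (w, w) > 0" using assms by (auto simp: rdd_def)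
  hence "0 < \<bar>?v $ w\<bar>" using v by simp
  also have "\<dots> \<le> linf_norm ?v"
    unfolding linf_norm_def using v(1) assms(3) by (intro Max_ge) auto
  finally show ?thesis .
qed

lemma L_param_unit_vec:
  assumes "M \<in> carrier_mat n n" "rdd M" "w < n"
  shows "L_param M (unit_vec n w) t \<gamma> \<epsilon> =
    1 / \<gamma> * log1 (d_max M * real (l0_norm t) * linf_norm (D_pow M (-1) *\<^sub>v t) / (\<gamma> * \<epsilon> * l1_norm t))"
proof -
  let ?x = "linf_norm (D_pow M (-1) *\<^sub>v unit_vec n w)"
  have "{i. i < dim_vec (unit_vec n w :: real vec) \<and> unit_vec n w $ i \<noteq> (0 :: real)} = {w}"
    using assms(3) by (auto split: if_splits)
  hence l0: "l0_norm (unit_vec n w) = 1" by (simp add: l0_norm_def)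
  have cancel: "1 / (\<gamma> * (\<epsilon> * l * x)) * d * m * y * 1 * x = d * m * y / (\<gamma> * \<epsilon> * l)"
    if "x > 0" for l x d m y :: real
    using that by simp
  show ?thesis
    unfolding L_param_def log_argument_def target_accuracy_def l0 of_nat_1
    by (subst cancel[OF D_inv_unit_vec_linf_pos[OF assms]]) (rule refl)
qed

end

theory Submission
  imports Defs
begin

text \<open>The lazy walk matrix \<open>W = (I + D\<^sup>-\<^sup>1 A\<^sup>T) / 2 = I - D\<^sup>-\<^sup>1 M / 2\<close> of an RDD matrix has absolute row sums at most
  \<open>1\<close>. Truncating the series for \<open>x\<^sup>*\<close> after \<open>K = \<lceil>B\<rceil>\<close> terms, \<open>B = 6 log \<Lambda> / \<gamma>\<close>, costs a quarter of the error budget: conjugating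
  \<open>W\<close> with \<open>D\<^sup>1\<^sup>/\<^sup>p\<close> gives a matrix contracting the \<open>p\<close>-norm on the range that contains the scaled right-hand side.

  The truncated sum is computed by pushing residuals through \<open>K\<close> layers, starting from \<open>1 / d\<^sub>w\<close> at \<open>w\<close> and dropping
  residuals of size at most \<open>\<theta> = \<epsilon> / (B\<^sup>2 d\<^sub>w)\<close>. As \<open>W\<^sup>T\<close> does not increase the 1-norm, what is dropped in a layer with \<open>k\<close> layers
  left changes the value by at most \<open>\<theta> k \<parallel>t\<parallel>\<^sub>1\<close>. The order of the pushes is irrelevant: weighting each
  residual by the work that a unit of it causes under \<open>\<bar>W\<bar>\<close> gives a potential which every push of a node decreases
  by at least \<open>\<theta>\<close> times its column length. Summed over all \<open>w\<close>, the initial weights are at most \<open>K nnz(M)\<close>,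
  again by the row sums, so that the average time is \<open>O(nnz(M) / n * K B\<^sup>2 / \<epsilon>)\<close>.\<close>

subsection \<open>Decay of the walk series\<close>

text \<open>Accuracy and time are separated, because the program has to halt in time for every
  \<open>w\<close>, whereas the contraction, and with it the link to \<open>x_star\<close>, is
  available only if \<open>unit_vec n w\<close> lies in the range of \<open>M\<close>. The time
  analysis does not use the decay. The error budget of a run is
  \<open>\<epsilon> * l1_norm t\<close> over the diagonal entry at \<open>w\<close>. A quarter pays
  for the truncation. The dropped residuals cost at most
  \<open>\<theta> * (K * (K + 1) / 2) * l1_norm t\<close>, halved by the factor 1/2 in front of the
  series, which fits into the other three quarters. Counting out the layers takes time of order
  \<open>B\<close>, and \<open>B ^ 3 / \<epsilon>\<close> covers this only for
  \<open>\<epsilon>\<close> up to the square of \<open>B\<close>. Hence the program answers 0 at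
  once if \<open>\<epsilon>\<close> is at least \<open>B\<close>; the three quarters then pay for
  the whole truncated sum. The known bound \<open>\<Lambda>\<close>, and so \<open>B\<close>, may
  differ from one \<open>w\<close> to the next. The average needs a common \<open>Bs\<close> above
  all of them; it exists because \<open>L_param\<close> is the same for all unit vectors.\<close>

lemma linf_norm_ge: "i < dim_vec v \<Longrightarrow> \<bar>v $ i\<bar> \<le> linf_norm v"
  unfolding linf_norm_def by (intro Max_ge) auto

lemma linf_norm_le:
  assumes "0 < dim_vec v" "\<And>i. i < dim_vec v \<Longrightarrow> \<bar>v $ i\<bar> \<le> c"
  shows "linf_norm v \<le> c"
  unfolding linf_norm_def using assms by (subst Max_le_iff) (auto simp: lessThan_empty_iff)

lemma lp_norm_ge_entry:
  assumes "1 \<le> p" "i < dim_vec v"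
  shows "\<bar>v $ i\<bar> \<le> lp_norm p v"
proof (cases "p = \<infinity>")
  case True
  then show ?thesis using linf_norm_ge assms by (simp add: lp_norm_def)
next
  case False
  with assms obtain r where r: "p = ereal r" "r \<ge> 1" by (cases p) auto
  have "\<bar>v $ i\<bar> powr r \<le> (\<Sum>i<dim_vec v. \<bar>v $ i\<bar> powr r)"
    using assms by (intro member_le_sum) auto
  hence "(\<bar>v $ i\<bar> powr r) powr (1/r) \<le> (\<Sum>i<dim_vec v. \<bar>v $ i\<bar> powr r) powr (1/r)"
    using r by (intro powr_mono2) auto
  thus ?thesis using r by (simp add: lp_norm_def powr_powr)
qed

lemma lp_norm_nonneg: "1 \<le> p \<Longrightarrow> 0 < dim_vec v \<Longrightarrow> 0 \<le> lp_norm p v"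
  using lp_norm_ge_entry[of p 0 v] by linarith

lemma lp_norm_mono:
  assumes "1 \<le> p" "0 < dim_vec v" "dim_vec u = dim_vec v"
    and le: "\<And>i. i < dim_vec v \<Longrightarrow> \<bar>v $ i\<bar> \<le> \<bar>u $ i\<bar>"
  shows "lp_norm p v \<le> lp_norm p u"
proof (cases "p = \<infinity>")
  case True
  have "linf_norm v \<le> linf_norm u"
    using assms le linf_norm_ge[of _ u] by (intro linf_norm_le) (auto intro: order_trans)
  then show ?thesis using True by (simp add: lp_norm_def)
next
  case False
  with assms obtain r where r: "p = ereal r" "r \<ge> 1" by (cases p) auto
  have "(\<Sum>i<dim_vec v. \<bar>v $ i\<bar> powr r) \<le> (\<Sum>i<dim_vec v. \<bar>u $ i\<bar> powr r)"
    using r le by (intro sum_mono powr_mono2) auto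
  thus ?thesis using r assms by (simp add: lp_norm_def powr_mono2 sum_nonneg)
qed

lemma lp_norm_smult:
  assumes "1 \<le> p" "0 < dim_vec v" "0 \<le> c"
  shows "lp_norm p (c \<cdot>\<^sub>v v) = c * lp_norm p v"
proof (cases "p = \<infinity>")
  case True
  have "linf_norm (c \<cdot>\<^sub>v v) = c * linf_norm v"
  proof -
    have "(\<lambda>i. \<bar>(c \<cdot>\<^sub>v v) $ i\<bar>) ` {..<dim_vec v} = (\<lambda>x. c * x) ` (\<lambda>i. \<bar>v $ i\<bar>) ` {..<dim_vec v}"
      unfolding image_image using assms by (intro image_cong) (auto simp: abs_mult)
    moreover have "Max ((\<lambda>x. c * x) ` (\<lambda>i. \<bar>v $ i\<bar>) ` {..<dim_vec v})
        = c * Max ((\<lambda>i. \<bar>v $ i\<bar>) ` {..<dim_vec v})"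
      using assms by (subst mono_Max_commute[symmetric])
        (auto simp: lessThan_empty_iff intro!: monoI mult_left_mono)
    ultimately show ?thesis unfolding linf_norm_def by simp
  qed
  then show ?thesis using True by (simp add: lp_norm_def)
next
  case False
  with assms obtain r where r: "p = ereal r" "r \<ge> 1" by (cases p) auto
  have "(\<Sum>i<dim_vec v. \<bar>(c \<cdot>\<^sub>v v) $ i\<bar> powr r) = c powr r * (\<Sum>i<dim_vec v. \<bar>v $ i\<bar> powr r)"
    unfolding sum_distrib_left using assms
    by (intro sum.cong) (auto simp: abs_mult powr_mult)
  thus ?thesis using r assms by (simp add: lp_norm_def powr_mult powr_powr sum_nonneg)
qed

lemma lp_norm_unit_vec:
  assumes "1 \<le> p" "w < n"
  shows "lp_norm p (unit_vec n w) = 1"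
proof (cases "p = \<infinity>")
  case True
  have "linf_norm (unit_vec n w) \<le> 1" using assms by (intro linf_norm_le) auto
  moreover have "1 \<le> linf_norm (unit_vec n w)"
    using linf_norm_ge[of w "unit_vec n w"] assms by auto
  ultimately show ?thesis using True by (simp add: lp_norm_def)
next
  case False
  with assms obtain r where r: "p = ereal r" "r \<ge> 1" by (cases p) auto
  have "(\<Sum>i<n. \<bar>unit_vec n w $ i\<bar> powr r) = (\<Sum>i<n. if i = w then 1 else 0)"
    using assms by (intro sum.cong) auto
  thus ?thesis using r assms by (simp add: lp_norm_def)
qed

section \<open>Operator norms on a subspace\<close>

lemma abs_mult_mat_vec_le:
  assumes "T \<in> carrier_mat n n" "v \<in> carrier_vec n" "i < n" "\<And>j. j < n \<Longrightarrow> \<bar>v $ j\<bar> \<le> 1"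
  shows "\<bar>(T *\<^sub>v v) $ i\<bar> \<le> (\<Sum>j<n. \<bar>T $$ (i, j)\<bar> :: real)"
proof -
  have "(T *\<^sub>v v) $ i = (\<Sum>j<n. T $$ (i, j) * v $ j)"
    using assms by (auto simp: scalar_prod_def atLeast0LessThan intro!: sum.cong)
  also have "\<bar>\<dots>\<bar> \<le> (\<Sum>j<n. \<bar>T $$ (i, j) * v $ j\<bar>)" by (rule sum_abs)
  also have "\<dots> \<le> (\<Sum>j<n. \<bar>T $$ (i, j)\<bar>)"
    using assms by (intro sum_mono) (auto simp: abs_mult intro: mult_left_le)
  finally show ?thesis .
qed

text \<open>Boundedness is what gives the real \<open>Sup\<close> its meaning. Vectors in the unit
  ball of any p-norm have entries of absolute value at most 1, so the vector of absolute row sums of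
  \<open>T\<close> dominates every image entrywise.\<close>

lemma op_norm_on_bdd_above:
  assumes "1 \<le> p" "T \<in> carrier_mat n n" "S \<subseteq> carrier_vec n" "0 < n"
  shows "bdd_above {lp_norm p (T *\<^sub>v v) | v. v \<in> S \<and> lp_norm p v \<le> 1}"
proof (rule bdd_aboveI[of _ "lp_norm p (Matrix.vec n (\<lambda>i. \<Sum>j<n. \<bar>T $$ (i, j)\<bar>))"])
  fix x assume "x \<in> {lp_norm p (T *\<^sub>v v) | v. v \<in> S \<and> lp_norm p v \<le> 1}"
  then obtain v where v: "x = lp_norm p (T *\<^sub>v v)" "v \<in> carrier_vec n" "lp_norm p v \<le> 1"
    using assms by auto
  have "\<bar>v $ j\<bar> \<le> 1" if "j < n" for j
    using lp_norm_ge_entry[of p j v] assms v that by auto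
  hence "\<bar>(T *\<^sub>v v) $ i\<bar> \<le> \<bar>\<Sum>j<n. \<bar>T $$ (i, j)\<bar>\<bar>" if "i < n" for i
    using abs_mult_mat_vec_le[OF assms(2) v(2) that] by fastforce
  thus "x \<le> lp_norm p (Matrix.vec n (\<lambda>i. \<Sum>j<n. \<bar>T $$ (i, j)\<bar>))"
    unfolding v(1) using assms by (intro lp_norm_mono) auto
qed

lemma op_norm_on_bound:
  assumes "1 \<le> p" "T \<in> carrier_mat n n" "S \<subseteq> carrier_vec n" "0 < n" "v \<in> S"
    and scale: "\<And>(c::real) v. v \<in> S \<Longrightarrow> c \<cdot>\<^sub>v v \<in> S"
  shows "lp_norm p (T *\<^sub>v v) \<le> op_norm_on p T S * lp_norm p v"
proof -
  let ?N = "lp_norm p v"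
  have v: "v \<in> carrier_vec n" using assms by auto
  have N0: "0 \<le> ?N" using lp_norm_nonneg assms v by auto
  have Tv: "dim_vec (T *\<^sub>v v) = n" using assms by auto
  show ?thesis
  proof (cases "?N = 0")
    \<comment> \<open>Norm 0 forces \<open>v\<close> to be zero; the rescaling to the unit sphere
      used in the other case would divide by 0.\<close>
    case True
    have "v $ j = 0" if "j < n" for j using lp_norm_ge_entry[of p j v] True that v assms by auto
    hence "v = 0 \<cdot>\<^sub>v v" using v by (intro eq_vecI) auto
    hence "T *\<^sub>v v = 0 \<cdot>\<^sub>v (T *\<^sub>v v)" using mult_mat_vec[OF assms(2) v, of 0] by simp
    hence "lp_norm p (T *\<^sub>v v) = lp_norm p (0 \<cdot>\<^sub>v (T *\<^sub>v v))" by simp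
    also have "\<dots> = 0" using lp_norm_smult[of p "T *\<^sub>v v" 0] assms Tv by simp
    finally show ?thesis using True by simp
  next
    case False
    define u where "u = (1 / ?N) \<cdot>\<^sub>v v"
    have "lp_norm p u = 1" unfolding u_def
      using False N0 lp_norm_smult[of p v "1 / ?N"] assms v by auto
    moreover have "u \<in> S" unfolding u_def using assms by auto
    ultimately have "lp_norm p (T *\<^sub>v u) \<le> op_norm_on p T S"
      unfolding op_norm_on_def by (intro cSup_upper op_norm_on_bdd_above[OF assms(1-4)]) auto
    moreover have "lp_norm p (T *\<^sub>v u) = 1 / ?N * lp_norm p (T *\<^sub>v v)"
      unfolding u_def mult_mat_vec[OF assms(2) v] using N0 assms Tv by (intro lp_norm_smult) auto
    ultimately show ?thesis using N0 False by (simp add: field_simps)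
  qed
qed

text \<open>The zero vector supplies a nonnegative member of the set under the \<open>Sup\<close>.
  The sign is needed to take powers monotonically and to get
  \<open>gamma_max M \<le> 1\<close>.\<close>

lemma op_norm_on_nonneg:
  assumes "1 \<le> p" "T \<in> carrier_mat n n" "S \<subseteq> carrier_vec n" "0 < n" "0\<^sub>v n \<in> S"
  shows "0 \<le> op_norm_on p T S"
proof -
  have "0\<^sub>v n = (0::real) \<cdot>\<^sub>v 0\<^sub>v n" by auto
  hence "lp_norm p (0\<^sub>v n) = 0" using lp_norm_smult[of p "0\<^sub>v n" 0] assms by simp
  hence "lp_norm p (T *\<^sub>v 0\<^sub>v n) \<le> op_norm_on p T S"
    unfolding op_norm_on_def using assms by (intro cSup_upper op_norm_on_bdd_above) auto
  moreover have "0 \<le> lp_norm p (T *\<^sub>v 0\<^sub>v n)" using assms by (intro lp_norm_nonneg) auto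
  ultimately show ?thesis by linarith
qed

section \<open>Conjugate exponents, and lazy matrices on their invariant range\<close>

lemma conjugate_exponents_inverse_sum:
  assumes "conjugate_exponents p q"
  shows "real_of_ereal (1 / p) + real_of_ereal (1 / q) = 1" "0 \<le> real_of_ereal (1 / p)"
    "0 \<le> real_of_ereal (1 / q)"
proof -
  have *: "1 / x \<noteq> \<infinity> \<and> 1 / x \<noteq> -\<infinity> \<and> 0 \<le> 1 / x" if "1 \<le> x" for x :: ereal
    using that by (cases x) (auto simp: one_ereal_def)
  from assms have pq: "1 \<le> p" "1 \<le> q" "1 / p + 1 / q = 1" by (auto simp: conjugate_exponents_def)
  from *[OF pq(1)] *[OF pq(2)] pq(3)
  show "real_of_ereal (1 / p) + real_of_ereal (1 / q) = 1" "0 \<le> real_of_ereal (1 / p)"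
    "0 \<le> real_of_ereal (1 / q)"
    by (cases "1 / p"; cases "1 / q"; auto simp: one_ereal_def)+
qed

lemma lazy_carrier: "X \<in> carrier_mat n n \<Longrightarrow> lazy X \<in> carrier_mat n n"
  by (auto simp: lazy_def)

lemma mult_vec_index: "X \<in> carrier_mat n n \<Longrightarrow> v \<in> carrier_vec n \<Longrightarrow> i < n \<Longrightarrow>
   (X *\<^sub>v v) $ i = (\<Sum>j<n. X $$ (i, j) * v $ j :: real)"
  by (auto simp: scalar_prod_def atLeast0LessThan intro!: sum.cong)

lemma lazy_mult_vec:
  assumes "X \<in> carrier_mat n n" "v \<in> carrier_vec n"
  shows "lazy X *\<^sub>v v = (1/2) \<cdot>\<^sub>v (v + X *\<^sub>v v)"
proof -
  have "lazy X *\<^sub>v v = (1/2) \<cdot>\<^sub>v ((1\<^sub>m n + X) *\<^sub>v v)"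
    using assms by (auto simp: lazy_def)
  also have "(1\<^sub>m n + X) *\<^sub>v v = v + X *\<^sub>v v"
    using assms by (subst add_mult_distrib_mat_vec[of _ n n]) auto
  finally show ?thesis .
qed

lemma pow_mat_Suc_mult_vec:
  assumes "X \<in> carrier_mat n n" "v \<in> carrier_vec n"
  shows "(X ^\<^sub>m Suc l) *\<^sub>v v = (X ^\<^sub>m l) *\<^sub>v (X *\<^sub>v v)"
  using assms by (simp add: assoc_mult_mat_vec[of _ n n _ n])

lemma mat_range_smult: "X \<in> carrier_mat n n \<Longrightarrow> v \<in> mat_range X \<Longrightarrow> (c::real) \<cdot>\<^sub>v v \<in> mat_range X"
  unfolding mat_range_def by (auto intro!: mult_mat_vec[symmetric] smult_carrier_vec)

lemma mat_range_carrier: "X \<in> carrier_mat n n \<Longrightarrow> mat_range X \<subseteq> carrier_vec n"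
  unfolding mat_range_def by auto

lemma zero_in_mat_range:
  assumes "X \<in> carrier_mat n n"
  shows "0\<^sub>v n \<in> mat_range X"
proof -
  have "X *\<^sub>v 0\<^sub>v n = 0\<^sub>v n" using assms by (intro eq_vecI) auto
  thus ?thesis unfolding mat_range_def using assms
    by (auto simp: eq_commute intro!: exI[of _ "0\<^sub>v n"])
qed

text \<open>\<open>lazy N\<close> is a polynomial in \<open>N\<close> and therefore commutes with
  \<open>1\<^sub>m n - N\<close>.\<close>

lemma lazy_range_invariant:
  assumes N: "N \<in> carrier_mat n n" and v: "v \<in> mat_range (1\<^sub>m n - N)"
  shows "lazy N *\<^sub>v v \<in> mat_range (1\<^sub>m n - N)"
proof -
  obtain y where y: "v = (1\<^sub>m n - N) *\<^sub>v y" "y \<in> carrier_vec n"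
    using v N by (auto simp: mat_range_def)
  have c: "1\<^sub>m n - N \<in> carrier_mat n n" using N by auto
  have "lazy N * (1\<^sub>m n - N) = (1\<^sub>m n - N) * lazy N"
  proof -
    have "lazy N * (1\<^sub>m n - N) = (1/2) \<cdot>\<^sub>m ((1\<^sub>m n + N) * (1\<^sub>m n - N))"
      unfolding lazy_def using N c by (subst mult_smult_assoc_mat[of _ n n _ n]) auto
    also have "(1\<^sub>m n + N) * (1\<^sub>m n - N) = (1\<^sub>m n - N) * (1\<^sub>m n + N)"
    proof -
      have NN: "N * N \<in> carrier_mat n n" using N by auto
      have "(1\<^sub>m n + N) * (1\<^sub>m n - N) = (1\<^sub>m n - N) + (N - N * N)"
      proof -
        have "(1\<^sub>m n + N) * (1\<^sub>m n - N) = 1\<^sub>m n * (1\<^sub>m n - N) + N * (1\<^sub>m n - N)"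
          using N c by (intro add_mult_distrib_mat[of _ n n _ _ n]) auto
        also have "N * (1\<^sub>m n - N) = N - N * N"
          using N by (subst mult_minus_distrib_mat[of _ n n _ n]) auto
        finally show ?thesis unfolding left_mult_one_mat[OF c] .
      qed
      moreover have "(1\<^sub>m n - N) * (1\<^sub>m n + N) = (1\<^sub>m n + N) - (N + N * N)"
      proof -
        have "(1\<^sub>m n - N) * (1\<^sub>m n + N) = 1\<^sub>m n * (1\<^sub>m n + N) - N * (1\<^sub>m n + N)"
          using N by (intro minus_mult_distrib_mat[of _ n n _ _ n]) auto
        also have "N * (1\<^sub>m n + N) = N + N * N"
          using N by (subst mult_add_distrib_mat[of _ n n _ n]) auto
        finally show ?thesis using N by simp
      qed
      moreover have "(1\<^sub>m n - N) + (N - N * N) = (1\<^sub>m n + N) - (N + N * N)"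
        using N NN by (intro eq_matI) auto
      ultimately show ?thesis by (simp only:)
    qed
    also have "(1/2) \<cdot>\<^sub>m ((1\<^sub>m n - N) * (1\<^sub>m n + N)) = (1\<^sub>m n - N) * lazy N"
      unfolding lazy_def using N c by (subst mult_smult_distrib[of _ n n _ n]) auto
    finally show ?thesis .
  qed
  hence "lazy N *\<^sub>v v = (1\<^sub>m n - N) *\<^sub>v (lazy N *\<^sub>v y)"
    unfolding y(1) assoc_mult_mat_vec[OF lazy_carrier[OF N] c y(2), symmetric]
      assoc_mult_mat_vec[OF c lazy_carrier[OF N] y(2), symmetric] by (simp only:)
  moreover have "lazy N *\<^sub>v y \<in> carrier_vec (dim_col (1\<^sub>m n - N))"
    unfolding carrier_matD(2)[OF c] by (intro mult_mat_vec_carrier[OF lazy_carrier[OF N]] y)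
  ultimately show ?thesis unfolding mat_range_def by blast
qed

text \<open>All iterates stay in the range, so the restricted operator norm applies once per factor.
  On the whole space a nonzero fixed vector of \<open>N\<close> would rule out any
  contraction.\<close>

lemma lazy_pow_lp_norm_le:
  assumes p: "1 \<le> p" and n: "0 < n" and N: "N \<in> carrier_mat n n" and z: "z \<in> mat_range (1\<^sub>m n - N)"
  defines "\<rho> \<equiv> op_norm_on p (lazy N) (mat_range (1\<^sub>m n - N))"
  shows "lp_norm p ((lazy N ^\<^sub>m l) *\<^sub>v z) \<le> \<rho> ^ l * lp_norm p z"
  using z
proof (induction l arbitrary: z)
  case 0
  have "1\<^sub>m n - N \<in> carrier_mat n n" using N by auto
  hence "z \<in> carrier_vec n" using 0 mat_range_carrier by auto
  thus ?case using lazy_carrier[OF N] by simp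
next
  case (Suc l)
  have c: "1\<^sub>m n - N \<in> carrier_mat n n" using N by auto
  hence z: "z \<in> carrier_vec n" using Suc.prems mat_range_carrier by auto
  have "0\<^sub>v n \<in> mat_range (1\<^sub>m n - N)"
    by (rule zero_in_mat_range[OF c])
  hence \<rho>0: "0 \<le> \<rho>"
    unfolding \<rho>_def by (intro op_norm_on_nonneg[OF p lazy_carrier[OF N] mat_range_carrier[OF c] n])
  have "lp_norm p ((lazy N ^\<^sub>m Suc l) *\<^sub>v z) = lp_norm p ((lazy N ^\<^sub>m l) *\<^sub>v (lazy N *\<^sub>v z))"
    by (simp only: pow_mat_Suc_mult_vec[OF lazy_carrier[OF N] z])
  also have "\<dots> \<le> \<rho> ^ l * lp_norm p (lazy N *\<^sub>v z)"
    by (intro Suc.IH lazy_range_invariant N Suc.prems)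
  also have "\<dots> \<le> \<rho> ^ l * (\<rho> * lp_norm p z)"
    unfolding \<rho>_def using \<rho>0 mat_range_smult[OF c] Suc.prems
    by (intro mult_left_mono op_norm_on_bound[OF p lazy_carrier[OF N] mat_range_carrier[OF c] n])
      (auto simp: \<rho>_def)
  finally show ?case by (simp add: mult_ac)
qed

section \<open>Similarity of the walk matrix to the matrices \<open>N_pq\<close>\<close>

context
  fixes M :: "real mat" and n :: nat
  assumes M: "M \<in> carrier_mat n n"
begin

lemma D_pow_carrier: "D_pow M s \<in> carrier_mat n n"
  using M by (auto simp: D_pow_def mat_diag_def)

lemma AT_part_carrier: "AT_part M \<in> carrier_mat n n"
  using M by (auto simp: AT_part_def mat_diag_def)

lemma N_pq_carrier: "N_pq p q M \<in> carrier_mat n n"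
  unfolding N_pq_def by (intro mult_carrier_mat[of _ n n _ n] D_pow_carrier AT_part_carrier)

lemma D_pow_mult_vec: "v \<in> carrier_vec n \<Longrightarrow> i < n \<Longrightarrow> (D_pow M s *\<^sub>v v) $ i = M $$ (i, i) powr s * v $ i"
proof -
  assume v: "v \<in> carrier_vec n" "i < n"
  have "(D_pow M s *\<^sub>v v) $ i = (\<Sum>j<n. if j = i then M $$ (i, i) powr s * v $ i else 0)"
    using v M by (simp add: D_pow_def mat_diag_def scalar_prod_def atLeast0LessThan if_distrib
        if_distribR cong: if_cong)
  thus ?thesis using v by simp
qed

lemma N_pq_mult_vec:
  assumes "v \<in> carrier_vec n"
  shows "N_pq p q M *\<^sub>v v = D_pow M (- real_of_ereal (1 / q)) *\<^sub>v
     (AT_part M *\<^sub>v (D_pow M (- real_of_ereal (1 / p)) *\<^sub>v v))"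
proof -
  note c = D_pow_carrier AT_part_carrier
  show ?thesis unfolding N_pq_def
    by (subst assoc_mult_mat_vec[of _ n n _ n], (intro mult_carrier_mat[of _ n n _ n] c assms)+,
        subst assoc_mult_mat_vec[of _ n n _ n])
      (use mult_mat_vec_carrier[OF c(1) assms] c in auto)
qed

lemma AT_part_mult_vec:
  assumes "v \<in> carrier_vec n" "i < n"
  shows "(AT_part M *\<^sub>v v) $ i = M $$ (i, i) * v $ i - (M *\<^sub>v v) $ i"
proof -
  have "AT_part M *\<^sub>v v = mat_diag n (\<lambda>i. M $$ (i, i)) *\<^sub>v v - M *\<^sub>v v"
    unfolding AT_part_def using M assms
    by (subst minus_mult_distrib_mat_vec[of _ n n]) (auto simp: mat_diag_def)
  moreover have "(mat_diag n (\<lambda>i. M $$ (i, i)) *\<^sub>v v) $ i = (\<Sum>j<n. if j = i then M $$ (i, i) * v $ i else 0)"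
    using assms M by (simp add: mat_diag_def scalar_prod_def atLeast0LessThan if_distrib
        if_distribR cong: if_cong)
  ultimately show ?thesis using assms M by simp
qed

lemma walk_matrix_carrier: "lazy (D_pow M (-1) * AT_part M) \<in> carrier_mat n n"
  by (intro lazy_carrier mult_carrier_mat[of _ n n _ n] D_pow_carrier AT_part_carrier)

lemma walk_matrix_mult_vec:
  assumes v: "v \<in> carrier_vec n" "i < n"
  shows "(lazy (D_pow M (-1) * AT_part M) *\<^sub>v v) $ i
    = 1/2 * (v $ i + M $$ (i, i) powr (-1) * (AT_part M *\<^sub>v v) $ i)"
proof -
  note c = D_pow_carrier AT_part_carrier
  have "lazy (D_pow M (-1) * AT_part M) *\<^sub>v v = (1/2) \<cdot>\<^sub>v (v + D_pow M (-1) *\<^sub>v (AT_part M *\<^sub>v v))"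
    by (subst lazy_mult_vec[where n = n], (intro mult_carrier_mat[of _ n n _ n] c v(1))+,
        subst assoc_mult_mat_vec[of _ n n _ n]) (use c v in auto)
  thus ?thesis using v D_pow_carrier[of "-1"] AT_part_carrier D_pow_mult_vec[of "AT_part M *\<^sub>v v" i "-1"] by simp
qed

lemma diag_le_d_max: "i < n \<Longrightarrow> M $$ (i, i) \<le> d_max M"
  unfolding d_max_def using M by (intro Max_ge) auto

text \<open>Since the two reciprocals add up to 1, D^-1 splits into the powers belonging to p and q.
  Pulling the first one out to the left leaves exactly \<open>N_pq p q M\<close>, and the identity
  part commutes with diagonal matrices.\<close>

lemma walk_matrix_conj:
  assumes "conjugate_exponents p q" "z \<in> carrier_vec n"
  defines "\<alpha> \<equiv> real_of_ereal (1 / p)"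
  shows "lazy (D_pow M (-1) * AT_part M) *\<^sub>v (D_pow M (-\<alpha>) *\<^sub>v z)
     = D_pow M (-\<alpha>) *\<^sub>v (lazy (N_pq p q M) *\<^sub>v z)"
proof (rule eq_vecI)
  define \<beta> where "\<beta> = real_of_ereal (1 / q)"
  have ab: "\<alpha> + \<beta> = 1" using conjugate_exponents_inverse_sum[OF assms(1)] by (simp add: \<alpha>_def \<beta>_def)
  let ?y = "D_pow M (-\<alpha>) *\<^sub>v z"
  let ?u = "AT_part M *\<^sub>v ?y"
  have y: "?y \<in> carrier_vec n" and u: "?u \<in> carrier_vec n"
    by (intro mult_mat_vec_carrier[of _ n n] D_pow_carrier AT_part_carrier assms(2))+
  have N: "N_pq p q M *\<^sub>v z = D_pow M (-\<beta>) *\<^sub>v ?u"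
    using N_pq_mult_vec[OF assms(2)] by (simp add: \<alpha>_def \<beta>_def)
  have Lz: "lazy (N_pq p q M) *\<^sub>v z \<in> carrier_vec n"
    by (intro mult_mat_vec_carrier[OF lazy_carrier[OF N_pq_carrier]] assms(2))
  show "dim_vec (lazy (D_pow M (-1) * AT_part M) *\<^sub>v ?y) = dim_vec (D_pow M (-\<alpha>) *\<^sub>v (lazy (N_pq p q M) *\<^sub>v z))"
    using walk_matrix_carrier D_pow_carrier[of "-\<alpha>"] by auto
  fix i assume "i < dim_vec (D_pow M (-\<alpha>) *\<^sub>v (lazy (N_pq p q M) *\<^sub>v z))"
  hence i: "i < n" using D_pow_carrier[of "-\<alpha>"] by auto
  have 1: "(lazy (N_pq p q M) *\<^sub>v z) $ i = 1/2 * (z $ i + M $$ (i, i) powr (-\<beta>) * ?u $ i)"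
    unfolding lazy_mult_vec[OF N_pq_carrier assms(2)] N
    using i assms(2) u D_pow_carrier[of "-\<beta>"] D_pow_mult_vec[OF u i, of "-\<beta>"] by auto
  have "-\<alpha> + -\<beta> = -1" using ab by simp
  hence 2: "M $$ (i, i) powr (-\<alpha>) * M $$ (i, i) powr (-\<beta>) = M $$ (i, i) powr (-1)"
    by (simp only: flip: powr_add)
  have 3: "x * (1/2 * (a + y * c)) = 1/2 * (x * a + x * y * c)" for x y a c :: real
    by (simp add: algebra_simps)
  show "(lazy (D_pow M (-1) * AT_part M) *\<^sub>v ?y) $ i
      = (D_pow M (-\<alpha>) *\<^sub>v (lazy (N_pq p q M) *\<^sub>v z)) $ i"
    unfolding walk_matrix_mult_vec[OF y i] D_pow_mult_vec[OF Lz i] 1 3 2 D_pow_mult_vec[OF assms(2) i] ..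
qed

lemma walk_matrix_pow_conj:
  assumes "conjugate_exponents p q" "z \<in> carrier_vec n"
  defines "\<alpha> \<equiv> real_of_ereal (1 / p)"
  shows "(lazy (D_pow M (-1) * AT_part M) ^\<^sub>m l) *\<^sub>v (D_pow M (-\<alpha>) *\<^sub>v z)
     = D_pow M (-\<alpha>) *\<^sub>v ((lazy (N_pq p q M) ^\<^sub>m l) *\<^sub>v z)"
  using assms(2)
proof (induction l arbitrary: z)
  case 0
  have "dim_row (lazy (N_pq p q M)) = n" "dim_row (lazy (D_pow M (-1) * AT_part M)) = n"
    using walk_matrix_carrier lazy_carrier[OF N_pq_carrier, of p q] by (blast dest: carrier_matD)+
  thus ?case using 0 mult_mat_vec_carrier[OF D_pow_carrier 0, of "-\<alpha>"] by simp
next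
  case (Suc l)
  have c: "lazy (N_pq p q M) *\<^sub>v z \<in> carrier_vec n" "D_pow M (-\<alpha>) *\<^sub>v z \<in> carrier_vec n"
    by (intro mult_mat_vec_carrier[of _ n n] lazy_carrier N_pq_carrier D_pow_carrier Suc.prems)+
  show ?case
    unfolding pow_mat_Suc_mult_vec[OF walk_matrix_carrier c(2)]
      pow_mat_Suc_mult_vec[OF lazy_carrier[OF N_pq_carrier] Suc.prems]
    using walk_matrix_conj[OF assms(1) Suc.prems] Suc.IH[OF c(1)] by (simp add: \<alpha>_def)
qed

lemma op_norm_lazy_N_pq_nonneg:
  assumes "0 < n" "conjugate_exponents p q"
  shows "0 \<le> op_norm_on p (lazy (N_pq p q M)) (mat_range (1\<^sub>m n - N_pq p q M))"
proof -
  have c: "1\<^sub>m n - N_pq p q M \<in> carrier_mat n n" by (intro minus_carrier_mat N_pq_carrier)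
  have "0\<^sub>v n \<in> mat_range (1\<^sub>m n - N_pq p q M)"
    by (rule zero_in_mat_range[OF c])
  thus ?thesis using assms op_norm_on_nonneg[OF _ lazy_carrier[OF N_pq_carrier] mat_range_carrier[OF c]]
    by (auto simp: conjugate_exponents_def)
qed

text \<open>The supremum in \<open>gamma_max\<close> need not be attained, which is why \<open>walk_decay\<close> below only gives
  the rate \<open>1 - \<gamma> / 2\<close>; this costs a factor of two in the number of layers.\<close>

lemma gamma_max_witness:
  assumes "0 < n" "c < gamma_max M"
  obtains p q where "conjugate_exponents p q"
    "c < 1 - op_norm_on p (lazy (N_pq p q M)) (mat_range (1\<^sub>m n - N_pq p q M))"
proof -
  have n: "dim_row M = n" using M by auto
  let ?G = "{1 - op_norm_on p (lazy (N_pq p q M)) (mat_range (1\<^sub>m n - N_pq p q M)) | p q.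
    conjugate_exponents p q}"
  \<comment> \<open>This pair makes the set under the supremum nonempty; 1 is an upper bound because
    operator norms are nonnegative.\<close>
  have "conjugate_exponents 1 \<infinity>" by (auto simp: conjugate_exponents_def)
  hence "?G \<noteq> {}" by blast
  moreover have "bdd_above ?G"
    using op_norm_lazy_N_pq_nonneg[OF assms(1)] by (intro bdd_aboveI[of _ 1]) fastforce
  ultimately have "\<exists>x\<in>?G. c < x" using assms(2) unfolding gamma_max_def n by (simp add: less_cSup_iff)
  thus ?thesis using that by blast
qed

lemma gamma_max_le_1: "0 < n \<Longrightarrow> gamma_max M \<le> 1"
proof (rule ccontr)
  assume n: "0 < n" and "\<not> gamma_max M \<le> 1"
  then obtain p q where "conjugate_exponents p q"
    "1 < 1 - op_norm_on p (lazy (N_pq p q M)) (mat_range (1\<^sub>m n - N_pq p q M))"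
    using gamma_max_witness[of 1] by auto
  thus False using op_norm_lazy_N_pq_nonneg[OF n, of p q] by linarith
qed

context
  assumes rdd: "rdd M"
begin

lemma diag_pos: "i < n \<Longrightarrow> 0 < M $$ (i, i)"
  using rdd M by (auto simp: rdd_def)

text \<open>The hypothesis on the right-hand side enters here. If \<open>b\<close> is M y and x is
  D^\<alpha> y, then D^-\<beta> (D - A^T) y is x minus \<open>N_pq p q M\<close> applied to x,
  because 1 - \<beta> = \<alpha>.\<close>

lemma scaled_rhs_in_range:
  assumes "conjugate_exponents p q" "b \<in> mat_range M"
  shows "D_pow M (- real_of_ereal (1 / q)) *\<^sub>v b \<in> mat_range (1\<^sub>m n - N_pq p q M)"
proof -
  define \<alpha> where "\<alpha> = real_of_ereal (1 / p)"
  define \<beta> where "\<beta> = real_of_ereal (1 / q)"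
  have ab: "\<alpha> + \<beta> = 1" using conjugate_exponents_inverse_sum[OF assms(1)] by (simp add: \<alpha>_def \<beta>_def)
  obtain y where y: "b = M *\<^sub>v y" "y \<in> carrier_vec n" using assms M by (auto simp: mat_range_def)
  let ?x = "D_pow M \<alpha> *\<^sub>v y"
  have x: "?x \<in> carrier_vec n" by (intro mult_mat_vec_carrier[OF D_pow_carrier] y)
  have My: "M *\<^sub>v y \<in> carrier_vec n" and Ay: "AT_part M *\<^sub>v y \<in> carrier_vec n"
    by (intro mult_mat_vec_carrier[of _ n n] M AT_part_carrier y)+
  have "D_pow M (-\<alpha>) *\<^sub>v ?x = y"
  proof (rule eq_vecI)
    show "dim_vec (D_pow M (-\<alpha>) *\<^sub>v ?x) = dim_vec y" using D_pow_carrier[of "-\<alpha>"] y by auto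
    fix i assume "i < dim_vec y"
    hence i: "i < n" using y by auto
    show "(D_pow M (-\<alpha>) *\<^sub>v ?x) $ i = y $ i"
      unfolding D_pow_mult_vec[OF x i] D_pow_mult_vec[OF y(2) i]
      using diag_pos[OF i] by (simp add: powr_minus field_simps)
  qed
  hence Nx: "N_pq p q M *\<^sub>v ?x = D_pow M (-\<beta>) *\<^sub>v (AT_part M *\<^sub>v y)"
    using N_pq_mult_vec[OF x, of p q] by (simp add: \<alpha>_def \<beta>_def)
  have "D_pow M (-\<beta>) *\<^sub>v b = (1\<^sub>m n - N_pq p q M) *\<^sub>v ?x"
  proof (rule eq_vecI)
    show "dim_vec (D_pow M (-\<beta>) *\<^sub>v b) = dim_vec ((1\<^sub>m n - N_pq p q M) *\<^sub>v ?x)"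
      using D_pow_carrier[of "-\<beta>"] N_pq_carrier[of p q] by auto
    fix i assume "i < dim_vec ((1\<^sub>m n - N_pq p q M) *\<^sub>v ?x)"
    hence i: "i < n" using N_pq_carrier[of p q] by auto
    have "((1\<^sub>m n - N_pq p q M) *\<^sub>v ?x) $ i = ?x $ i - (N_pq p q M *\<^sub>v ?x) $ i"
      using x N_pq_carrier[of p q] i by (subst minus_mult_distrib_mat_vec[of _ n n]) auto
    moreover have "M $$ (i, i) powr \<alpha> = M $$ (i, i) powr (-\<beta>) * M $$ (i, i)"
    proof -
      have "M $$ (i, i) powr (-\<beta> + 1) = M $$ (i, i) powr (-\<beta>) * M $$ (i, i)"
        unfolding powr_add using diag_pos[OF i] by simp
      moreover have "-\<beta> + 1 = \<alpha>" using ab by simp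
      ultimately show ?thesis by simp
    qed
    ultimately show "(D_pow M (-\<beta>) *\<^sub>v b) $ i = ((1\<^sub>m n - N_pq p q M) *\<^sub>v ?x) $ i"
      unfolding Nx y(1) D_pow_mult_vec[OF y(2) i] D_pow_mult_vec[OF My i] D_pow_mult_vec[OF Ay i]
        AT_part_mult_vec[OF y(2) i] by (simp add: algebra_simps)
  qed
  thus ?thesis unfolding mat_range_def \<beta>_def[symmetric] using x N_pq_carrier[of p q] by auto
qed

text \<open>The exponent p is only known to exist, so the bound must not mention it. Conjugation
  leaves the scaling factors of the nodes \<open>i\<close> and \<open>w\<close> with exponents
  -\<alpha> and -\<beta>; taking both to exponent -1 leaves d_i^\<beta> d_w^\<alpha>, which is at
  most \<open>d_max M\<close>.\<close>

lemma walk_decay: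
  assumes \<gamma>: "0 < \<gamma>" "\<gamma> \<le> gamma_max M" and w: "w < n" and b: "unit_vec n w \<in> mat_range M" and i: "i < n"
  shows "\<bar>((lazy (D_pow M (-1) * AT_part M) ^\<^sub>m l) *\<^sub>v (D_pow M (-1) *\<^sub>v unit_vec n w)) $ i\<bar>
    \<le> d_max M / (M $$ (i, i) * M $$ (w, w)) * (1 - \<gamma> / 2) ^ l"
proof -
  have n: "0 < n" using w by simp
  obtain p q where pq: "conjugate_exponents p q"
    and lt: "\<gamma> / 2 < 1 - op_norm_on p (lazy (N_pq p q M)) (mat_range (1\<^sub>m n - N_pq p q M))"
    using gamma_max_witness[OF n, of "\<gamma> / 2"] \<gamma> by auto
  define \<rho> where "\<rho> = op_norm_on p (lazy (N_pq p q M)) (mat_range (1\<^sub>m n - N_pq p q M))"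
  define \<alpha> where "\<alpha> = real_of_ereal (1 / p)"
  define \<beta> where "\<beta> = real_of_ereal (1 / q)"
  have ab: "\<alpha> + \<beta> = 1" "0 \<le> \<alpha>" "0 \<le> \<beta>"
    using conjugate_exponents_inverse_sum[OF pq] by (simp_all add: \<alpha>_def \<beta>_def)
  have p: "1 \<le> p" using pq by (auto simp: conjugate_exponents_def)
  define di dw where "di = M $$ (i, i)" and "dw = M $$ (w, w)"
  have d: "0 < di" "0 < dw" "di \<le> d_max M" "dw \<le> d_max M"
    using diag_pos diag_le_d_max i w by (auto simp: di_def dw_def)
  have e: "unit_vec n w \<in> carrier_vec n" by simp
  define z where "z = D_pow M (-\<beta>) *\<^sub>v unit_vec n w"
  have z: "z \<in> carrier_vec n" unfolding z_def by (intro mult_mat_vec_carrier[OF D_pow_carrier] e)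
  have zr: "z \<in> mat_range (1\<^sub>m n - N_pq p q M)"
    unfolding z_def \<beta>_def by (rule scaled_rhs_in_range[OF pq b])
  have "z = (dw powr (-\<beta>)) \<cdot>\<^sub>v unit_vec n w"
  proof (rule eq_vecI)
    show "dim_vec z = dim_vec ((dw powr (-\<beta>)) \<cdot>\<^sub>v unit_vec n w)" using z by simp
    fix j assume "j < dim_vec ((dw powr (-\<beta>)) \<cdot>\<^sub>v unit_vec n w)"
    hence "j < n" by simp
    thus "z $ j = ((dw powr (-\<beta>)) \<cdot>\<^sub>v unit_vec n w) $ j"
      using D_pow_mult_vec[OF e, of j "-\<beta>"] w by (auto simp: z_def dw_def unit_vec_def)
  qed
  hence z_norm: "lp_norm p z = dw powr (-\<beta>)"
    using lp_norm_smult[OF p, of "unit_vec n w"] lp_norm_unit_vec[OF p w] n by simp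
  have split: "D_pow M (-1) *\<^sub>v unit_vec n w = D_pow M (-\<alpha>) *\<^sub>v z"
  proof (rule eq_vecI)
    show "dim_vec (D_pow M (-1) *\<^sub>v unit_vec n w) = dim_vec (D_pow M (-\<alpha>) *\<^sub>v z)"
      using D_pow_carrier[of "-1"] D_pow_carrier[of "-\<alpha>"] by auto
    fix j assume "j < dim_vec (D_pow M (-\<alpha>) *\<^sub>v z)"
    hence j: "j < n" using D_pow_carrier[of "-\<alpha>"] by auto
    have "-\<alpha> + -\<beta> = -1" using ab by simp
    hence "M $$ (j, j) powr (-\<alpha>) * M $$ (j, j) powr (-\<beta>) = M $$ (j, j) powr (-1)"
      by (simp only: flip: powr_add)
    thus "(D_pow M (-1) *\<^sub>v unit_vec n w) $ j = (D_pow M (-\<alpha>) *\<^sub>v z) $ j"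
      unfolding D_pow_mult_vec[OF z j] using D_pow_mult_vec[OF e j]
      by (simp only: z_def mult.assoc[symmetric])
  qed
  let ?T = "lazy (N_pq p q M)"
  have Tz: "(?T ^\<^sub>m l) *\<^sub>v z \<in> carrier_vec n"
    using z pow_carrier_mat[OF lazy_carrier[OF N_pq_carrier]] by (intro mult_mat_vec_carrier)
  have "\<bar>((?T ^\<^sub>m l) *\<^sub>v z) $ i\<bar> \<le> lp_norm p ((?T ^\<^sub>m l) *\<^sub>v z)"
    using carrier_vecD[OF Tz] i by (intro lp_norm_ge_entry[OF p]) (simp only:)
  also have "\<dots> \<le> \<rho> ^ l * dw powr (-\<beta>)"
    using lazy_pow_lp_norm_le[OF p n N_pq_carrier zr, of l] by (simp add: \<rho>_def z_norm)
  also have "\<dots> \<le> (1 - \<gamma> / 2) ^ l * dw powr (-\<beta>)"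
    using lt op_norm_lazy_N_pq_nonneg[OF n pq] by (intro mult_right_mono power_mono) (auto simp: \<rho>_def)
  finally have T_le: "\<bar>((?T ^\<^sub>m l) *\<^sub>v z) $ i\<bar> \<le> (1 - \<gamma> / 2) ^ l * dw powr (-\<beta>)" .
  have "0 \<le> (1 - \<gamma> / 2) ^ l"
    using \<gamma> gamma_max_le_1[OF n] by (intro zero_le_power) auto
  have pw: "x powr (-a) = x powr c / x" if "0 < x" "c + a = 1" for x a c :: real
  proof -
    have "c = -a + 1" using that by linarith
    hence "x powr c = x powr (-a) * x powr 1" by (simp only: powr_add)
    thus ?thesis using that by simp
  qed
  have "di powr (-\<alpha>) * dw powr (-\<beta>) = (di powr \<beta> * dw powr \<alpha>) / (di * dw)"
    using pw[OF d(1), of \<beta> \<alpha>] pw[OF d(2), of \<alpha> \<beta>] ab by (simp add: add.commute)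
  also have "di powr \<beta> * dw powr \<alpha> \<le> d_max M powr \<beta> * d_max M powr \<alpha>"
    using d ab by (intro mult_mono powr_mono2) auto
  also have "d_max M powr \<beta> * d_max M powr \<alpha> = d_max M"
    using d ab powr_add[of "d_max M" \<beta> \<alpha>] by (simp add: add.commute)
  finally have c: "di powr (-\<alpha>) * dw powr (-\<beta>) \<le> d_max M / (di * dw)"
    using d by (simp add: divide_right_mono)
  have "\<bar>((lazy (D_pow M (-1) * AT_part M) ^\<^sub>m l) *\<^sub>v (D_pow M (-1) *\<^sub>v unit_vec n w)) $ i\<bar>
     = di powr (-\<alpha>) * \<bar>((?T ^\<^sub>m l) *\<^sub>v z) $ i\<bar>"
    unfolding split walk_matrix_pow_conj[OF pq z, folded \<alpha>_def] D_pow_mult_vec[OF Tz i] di_def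
    by (simp add: abs_mult)
  also have "\<dots> \<le> di powr (-\<alpha>) * ((1 - \<gamma> / 2) ^ l * dw powr (-\<beta>))"
    by (intro mult_left_mono T_le) auto
  also have "\<dots> = (di powr (-\<alpha>) * dw powr (-\<beta>)) * (1 - \<gamma> / 2) ^ l" by simp
  also have "\<dots> \<le> d_max M / (di * dw) * (1 - \<gamma> / 2) ^ l"
    by (intro mult_right_mono c) fact
  finally show ?thesis by (simp add: di_def dw_def)
qed

text \<open>Turns the weights of the entrywise decay into the two norms of \<open>t\<close> that
  occur in \<open>log_argument\<close>.\<close>

lemma sum_abs_div_diag_le:
  assumes t: "t \<in> carrier_vec n"
  shows "(\<Sum>i<n. \<bar>t $ i\<bar> / M $$ (i, i)) \<le> real (l0_norm t) * linf_norm (D_pow M (-1) *\<^sub>v t)"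
proof -
  let ?S = "{i. i < n \<and> t $ i \<noteq> 0}"
  have "(\<Sum>i<n. \<bar>t $ i\<bar> / M $$ (i, i)) = (\<Sum>i\<in>?S. \<bar>t $ i\<bar> / M $$ (i, i))"
    by (rule sum.mono_neutral_right) auto
  also have "\<dots> \<le> (\<Sum>i\<in>?S. linf_norm (D_pow M (-1) *\<^sub>v t))"
  proof (rule sum_mono)
    fix i assume "i \<in> ?S"
    hence i: "i < n" by simp
    have "\<bar>t $ i\<bar> / M $$ (i, i) = \<bar>(D_pow M (-1) *\<^sub>v t) $ i\<bar>"
      using diag_pos[OF i] D_pow_mult_vec[OF t i] by (simp add: powr_minus abs_mult divide_inverse)
    also have "\<dots> \<le> linf_norm (D_pow M (-1) *\<^sub>v t)"
      using i D_pow_carrier[of "-1"] by (intro linf_norm_ge) auto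
    finally show "\<bar>t $ i\<bar> / M $$ (i, i) \<le> linf_norm (D_pow M (-1) *\<^sub>v t)" .
  qed
  finally show ?thesis using t by (simp add: l0_norm_def)
qed

text \<open>Convergence of the series in \<open>x_star\<close> comes from the decay, by comparison
  with a geometric series; this is also what permits moving the scalar product inside the infinite
  sum.\<close>

lemma x_star_tail:
  assumes \<gamma>: "0 < \<gamma>" "\<gamma> \<le> gamma_max M" and w: "w < n" and b: "unit_vec n w \<in> mat_range M"
    and t: "t \<in> carrier_vec n"
  shows "\<bar>t \<bullet> x_star M (unit_vec n w) - 1/2 * (\<Sum>l<K. t \<bullet>
      ((lazy (D_pow M (-1) * AT_part M) ^\<^sub>m l) *\<^sub>v (D_pow M (-1) *\<^sub>v unit_vec n w)))\<bar>
    \<le> (1 - \<gamma> / 2) ^ K / \<gamma> * (d_max M * real (l0_norm t) * linf_norm (D_pow M (-1) *\<^sub>v t)) / M $$ (w, w)"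
proof -
  have n: "0 < n" using w by simp
  define y where "y l = (lazy (D_pow M (-1) * AT_part M) ^\<^sub>m l) *\<^sub>v (D_pow M (-1) *\<^sub>v unit_vec n w)" for l
  have y_dim: "dim_vec (y l) = n" for l
    using pow_carrier_mat[OF walk_matrix_carrier, of l] by (auto simp: y_def)
  define r where "r = 1 - \<gamma> / 2"
  have r: "0 \<le> r" "r < 1" using \<gamma> gamma_max_le_1[OF n] by (auto simp: r_def)
  define c where "c i = d_max M / (M $$ (i, i) * M $$ (w, w))" for i
  have decay: "\<bar>y l $ i\<bar> \<le> c i * r ^ l" if "i < n" for l i
    using walk_decay[OF \<gamma> w b that] by (simp add: y_def c_def r_def)
  have geo: "summable (\<lambda>l. r ^ l)" using r by (intro summable_geometric) auto
  have sm: "summable (\<lambda>l. y l $ i)" if "i < n" for i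
    by (rule summable_comparison_test'[of "\<lambda>l. c i * r ^ l" 0])
      (use geo decay that in \<open>auto intro: summable_mult\<close>)
  define f where "f l = (\<Sum>i<n. t $ i * y l $ i)" for l
  have f: "t \<bullet> y l = f l" for l
    using y_dim by (simp add: f_def scalar_prod_def atLeast0LessThan)
  have fs: "summable f" unfolding f_def using sm by (intro summable_sum summable_mult) auto
  have "t \<bullet> x_star M (unit_vec n w) = (\<Sum>i<n. t $ i * (1/2 * (\<Sum>l. y l $ i)))"
    using M by (auto simp: x_star_def scalar_prod_def atLeast0LessThan y_def intro!: sum.cong)
  also have "\<dots> = 1/2 * (\<Sum>i<n. t $ i * (\<Sum>l. y l $ i))"
    by (simp add: sum_divide_distrib)
  also have "(\<Sum>i<n. t $ i * (\<Sum>l. y l $ i)) = (\<Sum>i<n. \<Sum>l. t $ i * y l $ i)"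
    using sm by (intro sum.cong) (auto simp: suminf_mult)
  also have "\<dots> = (\<Sum>l. f l)"
    unfolding f_def using sm by (intro suminf_sum[symmetric] summable_mult) auto
  finally have x: "t \<bullet> x_star M (unit_vec n w) = 1/2 * (\<Sum>l. f l)" .
  define Q where "Q = d_max M * real (l0_norm t) * linf_norm (D_pow M (-1) *\<^sub>v t) / M $$ (w, w)"
  have dm: "0 \<le> d_max M" using diag_pos[OF w] diag_le_d_max[OF w] by linarith
  have "(\<Sum>i<n. \<bar>t $ i\<bar> * c i) = d_max M / M $$ (w, w) * (\<Sum>i<n. \<bar>t $ i\<bar> / M $$ (i, i))"
    unfolding c_def sum_distrib_left by (intro sum.cong) (auto simp: mult_ac)
  also have "\<dots> \<le> d_max M / M $$ (w, w) * (real (l0_norm t) * linf_norm (D_pow M (-1) *\<^sub>v t))"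
    using dm diag_pos[OF w] by (intro mult_left_mono sum_abs_div_diag_le t) auto
  finally have cQ: "(\<Sum>i<n. \<bar>t $ i\<bar> * c i) \<le> Q" by (simp add: Q_def)
  have f_le: "\<bar>f l\<bar> \<le> Q * r ^ l" for l
  proof -
    have "\<bar>f l\<bar> \<le> (\<Sum>i<n. \<bar>t $ i * y l $ i\<bar>)" unfolding f_def by (rule sum_abs)
    also have "\<dots> \<le> (\<Sum>i<n. \<bar>t $ i\<bar> * (c i * r ^ l))"
      unfolding abs_mult using decay by (intro sum_mono mult_left_mono) auto
    also have "\<dots> = (\<Sum>i<n. \<bar>t $ i\<bar> * c i) * r ^ l" by (simp add: sum_distrib_right mult.assoc)
    also have "\<dots> \<le> Q * r ^ l" using r by (intro mult_right_mono cQ) auto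
    finally show ?thesis .
  qed
  have g1: "(\<lambda>l. Q * r ^ (l + K)) sums (Q * r ^ K * (1 / (1 - r)))"
    using sums_mult[OF geometric_sums[of r], of "Q * r ^ K"] r by (simp add: power_add mult_ac)
  have fK: "summable (\<lambda>l. f (l + K))" using fs by (simp add: summable_iff_shift)
  have "\<bar>\<Sum>l. f (l + K)\<bar> \<le> (\<Sum>l. Q * r ^ (l + K))"
    using norm_suminf_le[of "\<lambda>l. f (l + K)", OF _ sums_summable[OF g1]] f_le by simp
  also have "\<dots> = Q * r ^ K * (1 / (1 - r))" using g1 by (rule sums_unique[symmetric])
  \<comment> \<open>\<open>1 - r\<close> is \<gamma> / 2; the resulting 2 cancels the 1/2 in front
    of the series.\<close>
  also have "\<dots> = 2 * (Q * r ^ K / \<gamma>)" using \<gamma> by (simp add: r_def)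
  finally have tail: "\<bar>\<Sum>l. f (l + K)\<bar> \<le> 2 * (Q * r ^ K / \<gamma>)" .
  have "(\<Sum>l. f l) = (\<Sum>l. f (l + K)) + (\<Sum>l<K. f l)" by (rule suminf_split_initial_segment[OF fs])
  hence "t \<bullet> x_star M (unit_vec n w) - 1/2 * (\<Sum>l<K. f l) = 1/2 * (\<Sum>l. f (l + K))"
    unfolding x by (simp add: field_simps)
  hence "\<bar>t \<bullet> x_star M (unit_vec n w) - 1/2 * (\<Sum>l<K. f l)\<bar> \<le> Q * r ^ K / \<gamma>"
    using tail by simp
  thus ?thesis by (simp add: f[unfolded y_def] Q_def r_def mult_ac)
qed

end

end

subsection \<open>Timed weakest preconditions\<close>

text \<open>Asserts that a halting run exists; as \<open>exec\<close> is deterministic, this is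
  total correctness. The running time is an argument of the postcondition, so that sequential
  composition can add up times.\<close>

definition wp :: "access \<Rightarrow> com \<Rightarrow> (nat \<Rightarrow> state \<Rightarrow> bool) \<Rightarrow> state \<Rightarrow> bool" where
  "wp A P Q s \<longleftrightarrow> (\<exists>k s'. exec A P s k s' \<and> Q k s')"

lemma wp_mono: "wp A P Q s \<Longrightarrow> (\<And>k s'. Q k s' \<Longrightarrow> Q' k s') \<Longrightarrow> wp A P Q' s"
  unfolding wp_def by blast

lemma wp_Skip: "Q 1 s \<Longrightarrow> wp A Skip Q s"
  unfolding wp_def by (blast intro: exec_Skip)

lemma wp_NSet: "Q 1 (set_nreg x (nval e s) s) \<Longrightarrow> wp A (NSet x e) Q s"
  unfolding wp_def by (blast intro: exec_NSet)

lemma wp_NStore: "Q 1 (set_narr a (nval i s) (nval e s) s) \<Longrightarrow> wp A (NStore a i e) Q s"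
  unfolding wp_def by (blast intro: exec_NStore)

lemma wp_RSet: "Q 1 (set_rreg x (rval e s) s) \<Longrightarrow> wp A (RSet x e) Q s"
  unfolding wp_def by (blast intro: exec_RSet)

lemma wp_RStore: "Q 1 (set_rarr a (nval i s) (rval e s) s) \<Longrightarrow> wp A (RStore a i e) Q s"
  unfolding wp_def by (blast intro: exec_RStore)

lemma wp_LoadDiag: "nval i s < dim_row (acc_mat A) \<Longrightarrow>
    Q 1 (set_rreg x (acc_mat A $$ (nval i s, nval i s)) s) \<Longrightarrow> wp A (LoadDiag x i) Q s"
  unfolding wp_def by (blast intro: exec_LoadDiag)

lemma wp_LoadT: "nval i s < dim_vec (acc_t A) \<Longrightarrow>
    Q 1 (set_rreg x (acc_t A $ nval i s) s) \<Longrightarrow> wp A (LoadT x i) Q s"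
  unfolding wp_def by (blast intro: exec_LoadT)

lemma wp_LoadCol: "nval j s < dim_col (acc_mat A) \<Longrightarrow>
    Q (1 + length (acc_cols A (nval j s)))
      (load_list k a c (acc_cols A (nval j s)) (\<lambda>i. acc_mat A $$ (i, nval j s)) s) \<Longrightarrow>
    wp A (LoadCol k a c j) Q s"
  unfolding wp_def by (blast intro: exec_LoadCol)

lemma wp_Seq: "wp A P (\<lambda>k. wp A R (\<lambda>l. Q (k + l))) s \<Longrightarrow> wp A (Seq P R) Q s"
  unfolding wp_def by (blast intro: exec_Seq)

lemma wp_Cond:
  assumes "bval b s \<Longrightarrow> wp A P (\<lambda>k. Q (1 + k)) s" "\<not> bval b s \<Longrightarrow> wp A R (\<lambda>k. Q (1 + k)) s"
  shows "wp A (Cond b P R) Q s"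
  using assms unfolding wp_def by (cases "bval b s") (blast intro: exec_CondT exec_CondF)+

text \<open>\<open>E\<close> is prepaid time. It is real-valued, so the induction runs over a
  natural upper bound of it: a turn lowers \<open>E\<close> by its cost plus 1 for the test, hence
  by at least 1. The 1 in the conclusion pays for the last, failing test.\<close>

lemma exec_while_potential:
  assumes step: "\<And>s. Inv s \<Longrightarrow> bval b s \<Longrightarrow> wp A P (\<lambda>k s'. Inv s' \<and> real k + 1 + E s' \<le> E s) s"
    and nonneg: "\<And>s. Inv s \<Longrightarrow> (0::real) \<le> E s"
    and "Inv s"
  shows "\<exists>k s'. exec A (While b P) s k s' \<and> Inv s' \<and> \<not> bval b s' \<and> real k \<le> 1 + E s"
proof -
  have "\<exists>k s'. exec A (While b P) s k s' \<and> Inv s' \<and> \<not> bval b s' \<and> real k \<le> 1 + E s"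
    if "Inv s" "E s \<le> real N" for N s
    using that
  proof (induction N arbitrary: s)
    case (0 s)
    show ?case
    proof (cases "bval b s")
      case True
      from step[OF 0(1) True] obtain k s' where "Inv s'" "real k + 1 + E s' \<le> E s"
        by (auto simp: wp_def)
      with nonneg[of s'] 0 have False by auto
      thus ?thesis ..
    next
      case False
      thus ?thesis using 0 nonneg[of s] exec_WhileF[of b s A P] by fastforce
    qed
  next
    case (Suc N s)
    show ?case
    proof (cases "bval b s")
      case True
      from step[OF Suc.prems(1) True] obtain k s' where
        s': "exec A P s k s'" "Inv s'" "real k + 1 + E s' \<le> E s"
        by (auto simp: wp_def)
      with Suc.prems have "E s' \<le> real N" by auto
      from Suc.IH[OF s'(2) this] obtain l s'' where
        s'': "exec A (While b P) s' l s''" "Inv s''" "\<not> bval b s''" "real l \<le> 1 + E s'" by blast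
      have "exec A (While b P) s (1 + k + l) s''" by (rule exec_WhileT[OF True s'(1) s''(1)])
      moreover have "real (1 + k + l) \<le> 1 + E s" using s' s'' by simp
      ultimately show ?thesis using s'' by blast
    next
      case False
      thus ?thesis using Suc.prems nonneg[of s] exec_WhileF[of b s A P] by fastforce
    qed
  qed
  from this[of s "nat \<lceil>E s\<rceil>"] \<open>Inv s\<close> show ?thesis by (simp add: real_nat_ceiling_ge)
qed

lemma wp_While:
  assumes "Inv s"
    and "\<And>s. Inv s \<Longrightarrow> bval b s \<Longrightarrow> wp A P (\<lambda>k s'. Inv s' \<and> real k + 1 + E s' \<le> E s) s"
    and "\<And>s. Inv s \<Longrightarrow> (0::real) \<le> E s"
    and "\<And>k s'. Inv s' \<Longrightarrow> \<not> bval b s' \<Longrightarrow> real k \<le> 1 + E s \<Longrightarrow> Q k s'"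
  shows "wp A (While b P) Q s"
  using exec_while_potential[of Inv b A P E, OF assms(2,3,1)] assms(4) unfolding wp_def by blast

lemmas wp_intros = wp_Seq wp_Skip wp_NSet wp_NStore wp_RSet wp_RStore wp_LoadDiag wp_LoadT wp_LoadCol
lemmas set_defs = set_nreg_def set_rreg_def set_narr_def set_rarr_def load_list_def

subsection \<open>The push program\<close>

text \<open>Memory layout. Natural registers: 2 and 7 hold \<open>K * n\<close> and the number \<open>K\<close> of layers, 3 is the stack
  pointer, 4 the current node \<open>u\<close>, 8 and 5 the offsets \<open>k * n\<close> and \<open>(k - 1) * n\<close> of the current and the
  next layer, 6 the loop counter of a column. Real registers: 3 holds \<open>B\<close>, 4 the accumulated value, 5 the squared
  threshold, 6 the residual being pushed. The arrays 0 and 1 of naturals are the stack of pairs (node, offset),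
  and the real array 0 holds the residual of node \<open>u\<close> with \<open>k\<close> layers left at index \<open>k * n + u\<close>. Offsets replace
  the layer numbers because the machine cannot multiply naturals.\<close>

definition spread_body :: com where
  "spread_body =
    Seq (NSet 6 (NSub (NReg 6) (NConst 1)))
    (Seq (LoadDiag 7 (NArr 2 (NReg 6)))
    (Seq (RStore 0 (NAdd (NReg 5) (NArr 2 (NReg 6)))
           (RSub (RArr 0 (NAdd (NReg 5) (NArr 2 (NReg 6))))
             (RDiv (RMul (RReg 6) (RArr 1 (NReg 6))) (RMul (ROfNat (NConst 2)) (RReg 7)))))
    (Seq (NStore 0 (NReg 3) (NArr 2 (NReg 6)))
    (Seq (NStore 1 (NReg 3) (NReg 5))
         (NSet 3 (NAdd (NReg 3) (NConst 1)))))))"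

definition spread :: com where
  "spread = While (NLess (NConst 0) (NReg 6)) spread_body"

text \<open>Moving the residual unchanged to the next layer is the identity part of the walk matrix;
  \<open>spread\<close> then subtracts the part coming from \<open>M\<close> along the listed
  column. No walk entry is formed, and the diagonal needs no separate case.\<close>

definition push_prepare :: com where
  "push_prepare =
    Seq (LoadT 8 (NReg 4))
    (Seq (RSet 4 (RAdd (RReg 4) (RMul (RReg 6) (RReg 8))))
    (Seq (NSet 5 (NSub (NReg 8) (NReg 0)))
    (Seq (RStore 0 (NAdd (NReg 8) (NReg 4)) (ROfNat (NConst 0)))
    (Seq (RStore 0 (NAdd (NReg 5) (NReg 4)) (RAdd (RArr 0 (NAdd (NReg 5) (NReg 4))) (RReg 6)))
         (LoadCol 6 2 1 (NReg 4))))))"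

definition push :: com where
  "push = Seq push_prepare spread"

definition pop_prepare :: com where
  "pop_prepare =
    Seq (NSet 3 (NSub (NReg 3) (NConst 1)))
    (Seq (NSet 4 (NArr 0 (NReg 3)))
    (Seq (NSet 8 (NArr 1 (NReg 3)))
         (RSet 6 (RArr 0 (NAdd (NReg 8) (NReg 4))))))"

text \<open>Stack entries may be repeated or outdated, so the residual is read again when its entry
  is popped. Offset 0 means that no layer is left. Squares replace absolute values, which the
  machine does not offer.\<close>

definition pop_body :: com where
  "pop_body = Seq pop_prepare
    (Cond (BAnd (NLess (NConst 0) (NReg 8)) (RLess (RReg 5) (RMul (RReg 6) (RReg 6)))) push Skip)"

definition push_all :: com where
  "push_all = While (NLess (NConst 0) (NReg 3)) pop_body"

text \<open>Computes the ceiling of \<open>B\<close> by counting, and its product with n by repeated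
  addition.\<close>

definition count_layers :: com where
  "count_layers = While (RLess (ROfNat (NReg 7)) (RReg 3))
    (Seq (NSet 7 (NAdd (NReg 7) (NConst 1))) (NSet 2 (NAdd (NReg 2) (NReg 0))))"

definition init_push :: com where
  "init_push =
    Seq (LoadDiag 7 (NReg 1))
    (Seq (RSet 5 (RDiv (RReg 0) (RMul (RMul (RReg 3) (RReg 3)) (RReg 7))))
    (Seq (RSet 5 (RMul (RReg 5) (RReg 5)))
    (Seq (RStore 0 (NAdd (NReg 2) (NReg 1)) (RDiv (ROfNat (NConst 1)) (RReg 7)))
    (Seq (NStore 0 (NConst 0) (NReg 1))
    (Seq (NStore 1 (NConst 0) (NReg 2))
         (NSet 3 (NConst 1)))))))"

definition push_phase :: com where
  "push_phase = Seq count_layers (Seq init_push (Seq push_all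
     (RSet 0 (RDiv (RReg 4) (ROfNat (NConst 2))))))"

definition solver_prepare :: com where
  "solver_prepare =
    Seq (RSet 2 (RLn (RReg 2)))
    (Seq (Cond (RLess (RReg 2) (ROfNat (NConst 1))) (RSet 2 (ROfNat (NConst 1))) Skip)
         (RSet 3 (RDiv (RMul (ROfNat (NConst 6)) (RReg 2)) (RReg 1))))"

definition solver :: com where
  "solver = Seq solver_prepare
     (Cond (RLess (RReg 0) (RReg 3)) push_phase (RSet 0 (ROfNat (NConst 0))))"

text \<open>The counter in register 6 runs downwards: the entries already treated are those with
  index at least its value, and the column reaches the stack in reverse order.\<close>

lemma wp_spread:
  fixes A :: access and s :: state and u :: nat
  defines "M \<equiv> acc_mat A"
  assumes len: "nreg s 6 = length is"
    and arr: "\<And>l. l < length is \<Longrightarrow> narr s 2 l = is ! l \<and> is ! l < dim_row M \<and> rarr s 1 l = M $$ (is ! l, u)"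
  shows "wp A spread (\<lambda>k s'. real k \<le> 1 + 7 * real (length is)
     \<and> nreg s' 0 = nreg s 0 \<and> nreg s' 3 = nreg s 3 + length is
     \<and> rreg s' 4 = rreg s 4 \<and> rreg s' 5 = rreg s 5
     \<and> (\<forall>p<nreg s 3. narr s' 0 p = narr s 0 p \<and> narr s' 1 p = narr s 1 p)
     \<and> (\<forall>q<length is. narr s' 0 (nreg s 3 + q) = is ! (length is - 1 - q) \<and> narr s' 1 (nreg s 3 + q) = nreg s 5)
     \<and> (\<forall>i. rarr s' 0 i = rarr s 0 i - (\<Sum>l<length is. if i = nreg s 5 + is ! l
           then rreg s 6 * M $$ (is ! l, u) / (2 * M $$ (is ! l, is ! l)) else 0))) s"
proof -
  let ?I = "\<lambda>s'. nreg s' 6 \<le> length is \<and> nreg s' 0 = nreg s 0 \<and> nreg s' 5 = nreg s 5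
     \<and> nreg s' 3 = nreg s 3 + (length is - nreg s' 6)
     \<and> rreg s' 4 = rreg s 4 \<and> rreg s' 5 = rreg s 5 \<and> rreg s' 6 = rreg s 6
     \<and> narr s' 2 = narr s 2 \<and> rarr s' 1 = rarr s 1
     \<and> (\<forall>p<nreg s 3. narr s' 0 p = narr s 0 p \<and> narr s' 1 p = narr s 1 p)
     \<and> (\<forall>q<length is - nreg s' 6. narr s' 0 (nreg s 3 + q) = is ! (length is - 1 - q) \<and> narr s' 1 (nreg s 3 + q) = nreg s 5)
     \<and> (\<forall>i. rarr s' 0 i = rarr s 0 i - (\<Sum>l\<in>{nreg s' 6..<length is}. if i = nreg s 5 + is ! l
           then rreg s 6 * M $$ (is ! l, u) / (2 * M $$ (is ! l, is ! l)) else 0))"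
  show ?thesis unfolding spread_def
  \<comment> \<open>7 is six commands of the body plus one test.\<close>
  proof (rule wp_While[where Inv = ?I and E = "\<lambda>s. 7 * real (nreg s 6)"])
    show "?I s" using len by simp
  next
    fix s' assume I: "?I s'" and b: "bval (NLess (NConst 0) (NReg 6)) s'"
    define j where "j = nreg s' 6 - 1"
    have j: "nreg s' 6 = Suc j" "j < length is" using b I by (auto simp: j_def)
    have aj: "narr s 2 j = is ! j" "is ! j < dim_row M" "rarr s 1 j = M $$ (is ! j, u)"
      using arr[OF j(2)] by auto
    have spl: "{j..<length is} = insert j {Suc j..<length is}" using j by auto
    have q: "length is - Suc (length is - Suc j) = j" using j by auto
    show "wp A spread_body (\<lambda>k s''. ?I s'' \<and> real k + 1 + 7 * real (nreg s'' 6) \<le> 7 * real (nreg s' 6)) s'"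
      unfolding spread_body_def
      apply (intro wp_intros)
      using I j aj
       apply (simp add: set_defs M_def)
      using I j aj
      apply (simp add: set_defs M_def[symmetric] spl less_diff_conv)
      apply (auto simp: less_Suc_eq Suc_diff_Suc q)
      apply (rule arg_cong[where f = "(!) is"])
      apply arith
      done
  next
    fix k s' assume I: "?I s'" and b: "\<not> bval (NLess (NConst 0) (NReg 6)) s'" and k: "real k \<le> 1 + 7 * real (nreg s 6)"
    hence "nreg s' 6 = 0" by simp
    thus "real k \<le> 1 + 7 * real (length is)
     \<and> nreg s' 0 = nreg s 0 \<and> nreg s' 3 = nreg s 3 + length is
     \<and> rreg s' 4 = rreg s 4 \<and> rreg s' 5 = rreg s 5
     \<and> (\<forall>p<nreg s 3. narr s' 0 p = narr s 0 p \<and> narr s' 1 p = narr s 1 p)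
     \<and> (\<forall>q<length is. narr s' 0 (nreg s 3 + q) = is ! (length is - 1 - q) \<and> narr s' 1 (nreg s 3 + q) = nreg s 5)
     \<and> (\<forall>i. rarr s' 0 i = rarr s 0 i - (\<Sum>l<length is. if i = nreg s 5 + is ! l
           then rreg s 6 * M $$ (is ! l, u) / (2 * M $$ (is ! l, is ! l)) else 0))"
      using I k len by (simp add: atLeast0LessThan)
  qed simp
qed

subsection \<open>Layer weights\<close>

definition walk :: "real mat \<Rightarrow> nat \<Rightarrow> nat \<Rightarrow> real" where
  "walk M r u = (if r = u then 1 else 0) - M $$ (r, u) / (2 * M $$ (r, r))"

text \<open>\<open>layer_sum n X f k\<close> is \<open>\<Sum>l<k. (X\<^sup>T)\<^sup>l f\<close>. With \<open>f = t\<close> it gives the value contributed by a unit of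
  residual that has \<open>k\<close> layers left; with \<open>\<bar>X\<bar>\<close> and column lengths it bounds the work caused by it.\<close>

primrec layer_sum :: "nat \<Rightarrow> (nat \<Rightarrow> nat \<Rightarrow> real) \<Rightarrow> (nat \<Rightarrow> real) \<Rightarrow> nat \<Rightarrow> nat \<Rightarrow> real" where
  "layer_sum n X f 0 u = 0"
| "layer_sum n X f (Suc k) u = f u + (\<Sum>r<n. X r u * layer_sum n X f k r)"

text \<open>Used twice: for the values, to bound what dropped residuals are worth, and for the
  costs, to bound the work summed over all start nodes.\<close>

lemma layer_sum_l1:
  assumes "\<And>r. r < n \<Longrightarrow> (\<Sum>u<n. \<bar>X r u\<bar>) \<le> 1"
  shows "(\<Sum>u<n. \<bar>layer_sum n X f k u\<bar>) \<le> real k * (\<Sum>u<n. \<bar>f u\<bar>)"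
proof (induction k)
  case (Suc k)
  have "(\<Sum>u<n. \<bar>layer_sum n X f (Suc k) u\<bar>) \<le> (\<Sum>u<n. \<bar>f u\<bar> + (\<Sum>r<n. \<bar>X r u\<bar> * \<bar>layer_sum n X f k r\<bar>))"
  proof (rule sum_mono)
    fix u
    have "\<bar>\<Sum>r<n. X r u * layer_sum n X f k r\<bar> \<le> (\<Sum>r<n. \<bar>X r u\<bar> * \<bar>layer_sum n X f k r\<bar>)"
      unfolding abs_mult[symmetric] by (rule sum_abs)
    thus "\<bar>layer_sum n X f (Suc k) u\<bar> \<le> \<bar>f u\<bar> + (\<Sum>r<n. \<bar>X r u\<bar> * \<bar>layer_sum n X f k r\<bar>)"
      unfolding layer_sum.simps by linarith
  qed
  also have "\<dots> = (\<Sum>u<n. \<bar>f u\<bar>) + (\<Sum>r<n. (\<Sum>u<n. \<bar>X r u\<bar>) * \<bar>layer_sum n X f k r\<bar>)"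
    unfolding sum.distrib sum_distrib_right by (subst sum.swap) simp
  also have "(\<Sum>r<n. (\<Sum>u<n. \<bar>X r u\<bar>) * \<bar>layer_sum n X f k r\<bar>) \<le> (\<Sum>r<n. 1 * \<bar>layer_sum n X f k r\<bar>)"
    using assms by (intro sum_mono mult_right_mono) auto
  finally show ?case using Suc by (simp add: algebra_simps)
qed simp

lemma layer_sum_nonneg:
  assumes "\<And>r u. r < n \<Longrightarrow> u < n \<Longrightarrow> 0 \<le> X r u" "\<And>u. u < n \<Longrightarrow> 0 \<le> f u" "u < n"
  shows "0 \<le> layer_sum n X f k u"
  using assms(3)
proof (induction k arbitrary: u)
  case (Suc k)
  thus ?case using assms(1,2) by (auto intro!: add_nonneg_nonneg sum_nonneg mult_nonneg_nonneg)
qed simp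

text \<open>Lets the number of layers of an individual run be replaced by a number common to all
  \<open>w\<close>.\<close>

lemma layer_sum_mono:
  assumes "\<And>r u. r < n \<Longrightarrow> u < n \<Longrightarrow> 0 \<le> X r u" "\<And>u. u < n \<Longrightarrow> 0 \<le> f u" "u < n" "k \<le> k'"
  shows "layer_sum n X f k u \<le> layer_sum n X f k' u"
proof -
  have "layer_sum n X f k u \<le> layer_sum n X f (Suc k) u" if "u < n" for k u
    using that
  proof (induction k arbitrary: u)
    case 0
    thus ?case using assms(2) by simp
  next
    case (Suc k)
    thus ?case unfolding layer_sum.simps(2)[of n X f "Suc k"] layer_sum.simps(2)[of n X f k u]
      using assms(1) by (intro add_left_mono sum_mono mult_left_mono) auto
  qed
  thus ?thesis using lift_Suc_mono_le[of "\<lambda>k. layer_sum n X f k u"] assms(3,4) by blast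
qed

text \<open>Change of the residual table when \<open>v\<close> is pushed from node \<open>u\<close>
  with \<open>Suc k\<close> layers left. The matrix is a parameter because the change of the
  absolute values is dominated by the same expression for the absolute walk matrix.\<close>

definition push_delta :: "(nat \<Rightarrow> nat \<Rightarrow> real) \<Rightarrow> real \<Rightarrow> nat \<Rightarrow> nat \<Rightarrow> nat \<Rightarrow> nat \<Rightarrow> real" where
  "push_delta X v k u j x =
     (if j = Suc k then if x = u then - v else 0 else if j = k then v * X x u else 0)"

text \<open>For \<open>F = layer_sum n X f\<close> the right-hand side is \<open>- v * f u\<close>,
  by the recursion of \<open>layer_sum\<close>. Both the potential and the value argument are
  instances of this.\<close>

lemma sum_push_delta:
  assumes "k < K" "u < n"
  shows "(\<Sum>j\<le>K. \<Sum>x<n. push_delta X v k u j x * F j x) = v * (\<Sum>x<n. X x u * F k x) - v * F (Suc k) u"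
proof -
  let ?a = "- v * F (Suc k) u" and ?b = "v * (\<Sum>x<n. X x u * F k x)"
  have "(\<Sum>x<n. push_delta X v k u j x * F j x)
      = (if j = Suc k then ?a else 0) + (if j = k then ?b else 0)" for j
  proof (cases "j = Suc k")
    case True
    have "(\<Sum>x<n. push_delta X v k u j x * F j x) = (\<Sum>x<n. if x = u then - v * F (Suc k) u else 0)"
      using True by (intro sum.cong) (auto simp: push_delta_def)
    thus ?thesis using True assms by simp
  next
    case False
    thus ?thesis by (auto simp: push_delta_def sum_distrib_left mult.assoc)
  qed
  hence "(\<Sum>j\<le>K. \<Sum>x<n. push_delta X v k u j x * F j x)
      = (\<Sum>j\<le>K. (if j = Suc k then ?a else 0) + (if j = k then ?b else 0))" by simp
  also have "\<dots> = ?a + ?b" unfolding sum.distrib using assms by simp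
  finally show ?thesis by simp
qed

lemma layer_index_inj:
  assumes "(x::nat) < n" "y < n"
  shows "j * n + x = k * n + y \<longleftrightarrow> j = k \<and> x = y"
proof
  assume eq: "j * n + x = k * n + y"
  have "(j * n + x) div n = (k * n + y) div n" "(j * n + x) mod n = (k * n + y) mod n"
    by (simp_all only: eq)
  thus "j = k \<and> x = y" using assms by simp
qed simp

subsection \<open>Invariants of the push program\<close>

text \<open>The start node is not fixed: values and costs of the layers depend only on
  \<open>M\<close>, \<open>t\<close> and the column lists, so that they can be summed over all start
  nodes.\<close>

locale push_input =
  fixes A :: access and n :: nat and M :: "real mat" and t :: "real vec"
  assumes acc [simp]: "acc_mat A = M" "acc_t A = t"
    and M: "M \<in> carrier_mat n n" and t: "t \<in> carrier_vec n" and rdd: "rdd M"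
    and cols: "\<And>j. j < n \<Longrightarrow> distinct (acc_cols A j) \<and> set (acc_cols A j) = {i. i < n \<and> M $$ (i, j) \<noteq> 0}"
begin

abbreviation "W \<equiv> walk M"
abbreviation "deg u \<equiv> real (length (acc_cols A u))"
abbreviation "val_layer \<equiv> layer_sum n W (\<lambda>u. t $ u)"
abbreviation "cost_layer \<equiv> layer_sum n (\<lambda>r u. \<bar>W r u\<bar>) (\<lambda>u. deg u)"
abbreviation "residual s k u \<equiv> rarr s 0 (k * n + u)"

lemma dims [simp]: "dim_row M = n" "dim_col M = n" "dim_vec t = n"
  using M t by auto

lemmas diag = diag_pos[OF M rdd]

text \<open>Laziness puts exactly 1/2 on the diagonal, and diagonal dominance leaves at most 1/2 for
  the rest of the row.\<close>

lemma walk_row_sum: "r < n \<Longrightarrow> (\<Sum>u<n. \<bar>W r u\<bar>) \<le> 1"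
proof -
  assume r: "r < n"
  have "(\<Sum>u<n. \<bar>W r u\<bar>) = \<bar>W r r\<bar> + (\<Sum>u\<in>{..<n} - {r}. \<bar>W r u\<bar>)"
    using r by (subst sum.remove[of _ r]) auto
  also have "\<bar>W r r\<bar> = 1 / 2" using diag[OF r] by (simp add: walk_def)
  also have "(\<Sum>u\<in>{..<n} - {r}. \<bar>W r u\<bar>) = (\<Sum>u\<in>{..<n} - {r}. \<bar>M $$ (r, u)\<bar>) / (2 * M $$ (r, r))"
    unfolding sum_divide_distrib using diag[OF r] by (intro sum.cong) (auto simp: walk_def)
  also have "\<dots> \<le> M $$ (r, r) / (2 * M $$ (r, r))"
    using rdd r diag[OF r] by (intro divide_right_mono) (auto simp: rdd_def)
  finally show ?thesis using diag[OF r] by simp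
qed

text \<open>The diagonal entry is listed in its own column. This allows charging the constant cost
  of a push to the column length.\<close>

lemma deg_ge_1: "u < n \<Longrightarrow> 1 \<le> deg u"
proof -
  assume u: "u < n"
  hence "u \<in> set (acc_cols A u)" using cols diag[of u] by auto
  hence "acc_cols A u \<noteq> []" by auto
  thus ?thesis by (cases "acc_cols A u") auto
qed

lemma wp_push:
  assumes s: "nreg s 0 = n" "nreg s 4 = u" "nreg s 8 = Suc k * n" "rreg s 6 = residual s (Suc k) u"
    and u: "u < n"
  shows "wp A push (\<lambda>c s'. real c \<le> 7 + 8 * deg u
     \<and> nreg s' 0 = n \<and> nreg s' 3 = nreg s 3 + length (acc_cols A u)
     \<and> rreg s' 4 = rreg s 4 + rreg s 6 * t $ u \<and> rreg s' 5 = rreg s 5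
     \<and> (\<forall>p<nreg s 3. narr s' 0 p = narr s 0 p \<and> narr s' 1 p = narr s 1 p)
     \<and> (\<forall>q<length (acc_cols A u). narr s' 0 (nreg s 3 + q) = acc_cols A u ! (length (acc_cols A u) - 1 - q)
          \<and> narr s' 1 (nreg s 3 + q) = k * n)
     \<and> (\<forall>j. \<forall>x<n. residual s' j x = residual s j x + push_delta W (rreg s 6) k u j x)) s"
proof -
  let ?is = "acc_cols A u"
  have d: "distinct ?is" and set_is: "set ?is = {i. i < n \<and> M $$ (i, u) \<noteq> 0}" using cols[OF u] by auto
  have nth: "?is ! l < n" if "l < length ?is" for l using set_is that nth_mem by blast
  let ?v = "rreg s 6"
  \<comment> \<open>The column is listed without repetition and flat indices are injective, so at
    most one summand survives. For rows that are not listed both sides vanish, as the entry of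
    \<open>M\<close> is 0.\<close>
  have sm: "(\<Sum>l<length ?is. if j * n + x = k * n + ?is ! l then ?v * M $$ (?is ! l, u) / (2 * M $$ (?is ! l, ?is ! l)) else 0)
     = (if j = k then ?v * M $$ (x, u) / (2 * M $$ (x, x)) else 0)" if x: "x < n" for j x
  proof -
    have "(\<Sum>l<length ?is. if j * n + x = k * n + ?is ! l then ?v * M $$ (?is ! l, u) / (2 * M $$ (?is ! l, ?is ! l)) else 0)
       = (\<Sum>r\<in>set ?is. if j * n + x = k * n + r then ?v * M $$ (r, u) / (2 * M $$ (r, r)) else 0)"
      using bij_betw_nth[OF d refl refl] by (rule sum.reindex_bij_betw)
    also have "\<dots> = (\<Sum>r\<in>set ?is. if x = r then if j = k then ?v * M $$ (x, u) / (2 * M $$ (x, x)) else 0 else 0)"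
      using set_is layer_index_inj[OF x] by (intro sum.cong) auto
    also have "\<dots> = (if j = k then ?v * M $$ (x, u) / (2 * M $$ (x, x)) else 0)"
      using set_is x by (subst sum.delta') auto
    finally show ?thesis .
  qed
  have ne: "n + k * n + u \<noteq> k * n + u" using u by simp
  have Wxu: "push_delta W ?v k u j x = (if j = Suc k then if x = u then - ?v else 0 else
      if j = k then (if x = u then ?v else 0) - ?v * M $$ (x, u) / (2 * M $$ (x, x)) else 0)" for j x
    by (simp add: push_delta_def walk_def algebra_simps)
  have idx: "(j * n + x = n + k * n + u) = (j = Suc k \<and> x = u)" "(j * n + x = k * n + u) = (j = k \<and> x = u)"
    if "x < n" for j x
    using layer_index_inj[OF that u, of j "Suc k"] layer_index_inj[OF that u, of j k] by simp_all
  have prep: "wp A push_prepare (\<lambda>c s1. c = 6 + length ?is \<and> nreg s1 0 = n \<and> nreg s1 3 = nreg s 3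
     \<and> nreg s1 5 = k * n \<and> nreg s1 6 = length ?is \<and> rreg s1 4 = rreg s 4 + ?v * t $ u
     \<and> rreg s1 5 = rreg s 5 \<and> rreg s1 6 = ?v \<and> narr s1 0 = narr s 0 \<and> narr s1 1 = narr s 1
     \<and> (\<forall>l<length ?is. narr s1 2 l = ?is ! l \<and> rarr s1 1 l = M $$ (?is ! l, u))
     \<and> (\<forall>j. \<forall>x<n. residual s1 j x = residual s j x
          + (if j = Suc k \<and> x = u then - ?v else if j = k \<and> x = u then ?v else 0))) s"
    unfolding push_prepare_def
    apply (intro wp_Seq wp_LoadT wp_RSet wp_NSet wp_RStore wp_LoadCol)
    using s u apply (simp add: set_defs)
    using s u apply (simp add: set_defs)
    using s u ne by (simp add: set_defs idx)
  show ?thesis unfolding push_def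
  proof (rule wp_Seq, rule wp_mono[OF prep], elim conjE)
    fix c :: nat and s1 :: state
    assume c: "c = 6 + length ?is" and s1: "nreg s1 0 = n" "nreg s1 3 = nreg s 3"
     "nreg s1 5 = k * n" "nreg s1 6 = length ?is" "rreg s1 4 = rreg s 4 + ?v * t $ u"
     "rreg s1 5 = rreg s 5" "rreg s1 6 = ?v" "narr s1 0 = narr s 0" "narr s1 1 = narr s 1"
     "\<forall>l<length ?is. narr s1 2 l = ?is ! l \<and> rarr s1 1 l = M $$ (?is ! l, u)"
     "\<forall>j. \<forall>x<n. residual s1 j x = residual s j x
          + (if j = Suc k \<and> x = u then - ?v else if j = k \<and> x = u then ?v else 0)"
    have spread: "wp A spread (\<lambda>k' s'. real k' \<le> 1 + 7 * deg u
       \<and> nreg s' 0 = nreg s1 0 \<and> nreg s' 3 = nreg s1 3 + length ?is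
       \<and> rreg s' 4 = rreg s1 4 \<and> rreg s' 5 = rreg s1 5
       \<and> (\<forall>p<nreg s1 3. narr s' 0 p = narr s1 0 p \<and> narr s' 1 p = narr s1 1 p)
       \<and> (\<forall>q<length ?is. narr s' 0 (nreg s1 3 + q) = ?is ! (length ?is - 1 - q) \<and> narr s' 1 (nreg s1 3 + q) = nreg s1 5)
       \<and> (\<forall>i. rarr s' 0 i = rarr s1 0 i - (\<Sum>l<length ?is. if i = nreg s1 5 + ?is ! l
             then rreg s1 6 * M $$ (?is ! l, u) / (2 * M $$ (?is ! l, ?is ! l)) else 0))) s1"
      by (rule wp_spread[of s1 ?is A u, unfolded acc]) (use s1 nth in auto)
    show "wp A spread (\<lambda>l s'. real (c + l) \<le> 7 + 8 * deg u
     \<and> nreg s' 0 = n \<and> nreg s' 3 = nreg s 3 + length ?is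
     \<and> rreg s' 4 = rreg s 4 + ?v * t $ u \<and> rreg s' 5 = rreg s 5
     \<and> (\<forall>p<nreg s 3. narr s' 0 p = narr s 0 p \<and> narr s' 1 p = narr s 1 p)
     \<and> (\<forall>q<length ?is. narr s' 0 (nreg s 3 + q) = ?is ! (length ?is - 1 - q) \<and> narr s' 1 (nreg s 3 + q) = k * n)
     \<and> (\<forall>j. \<forall>x<n. residual s' j x = residual s j x + push_delta W ?v k u j x)) s1"
    proof (rule wp_mono[OF spread], elim conjE, intro conjI)
      fix l :: nat and s' :: state
      assume l: "real l \<le> 1 + 7 * deg u"
      show "real (c + l) \<le> 7 + 8 * deg u" using l c by simp
    next
      fix l :: nat and s' :: state
      assume R: "\<forall>i. rarr s' 0 i = rarr s1 0 i - (\<Sum>l<length ?is. if i = nreg s1 5 + ?is ! l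
             then rreg s1 6 * M $$ (?is ! l, u) / (2 * M $$ (?is ! l, ?is ! l)) else 0)"
      show "\<forall>j. \<forall>x<n. residual s' j x = residual s j x + push_delta W ?v k u j x"
      proof (intro allI impI)
        fix j x assume x: "x < n"
        have "residual s' j x = residual s1 j x - (if j = k then ?v * M $$ (x, u) / (2 * M $$ (x, x)) else 0)"
          unfolding R[rule_format] s1 sm[OF x] ..
        thus "residual s' j x = residual s j x + push_delta W ?v k u j x"
          unfolding Wxu s1(11)[rule_format, OF x] by (cases "j = Suc k"; cases "j = k"; cases "x = u") simp_all
      qed
    qed (use s1 in simp_all)
  qed
qed

section \<open>Potential and value under a push\<close>

lemma cost_layer_nonneg: "u < n \<Longrightarrow> 0 \<le> cost_layer k u"
  by (rule layer_sum_nonneg) auto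

text \<open>The pushed residual falls to exactly 0, so its absolute value drops by all of
  \<open>\<bar>v\<bar>\<close>; elsewhere the triangle inequality suffices.\<close>

lemma potential_push_le:
  assumes k: "k < K" and u: "u < n" and v: "v = residual s (Suc k) u"
    and upd: "\<And>j x. x < n \<Longrightarrow> residual s' j x = residual s j x + push_delta W v k u j x"
  shows "(\<Sum>j\<le>K. \<Sum>x<n. \<bar>residual s' j x\<bar> * cost_layer j x)
    \<le> (\<Sum>j\<le>K. \<Sum>x<n. \<bar>residual s j x\<bar> * cost_layer j x) - \<bar>v\<bar> * deg u"
proof -
  let ?X = "\<lambda>r u. \<bar>W r u\<bar>"
  have le: "\<bar>residual s' j x\<bar> \<le> \<bar>residual s j x\<bar> + push_delta ?X \<bar>v\<bar> k u j x" if "x < n" for j x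
    unfolding upd[OF that] push_delta_def by (auto simp: v abs_mult[symmetric])
  have "(\<Sum>j\<le>K. \<Sum>x<n. \<bar>residual s' j x\<bar> * cost_layer j x)
     \<le> (\<Sum>j\<le>K. \<Sum>x<n. (\<bar>residual s j x\<bar> + push_delta ?X \<bar>v\<bar> k u j x) * cost_layer j x)"
    by (intro sum_mono mult_right_mono le cost_layer_nonneg) auto
  also have "\<dots> = (\<Sum>j\<le>K. \<Sum>x<n. \<bar>residual s j x\<bar> * cost_layer j x)
     + (\<Sum>j\<le>K. \<Sum>x<n. push_delta ?X \<bar>v\<bar> k u j x * cost_layer j x)"
    by (simp add: distrib_right sum.distrib)
  also have "(\<Sum>j\<le>K. \<Sum>x<n. push_delta ?X \<bar>v\<bar> k u j x * cost_layer j x) = - (\<bar>v\<bar> * deg u)"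
    unfolding sum_push_delta[OF k u] by (simp add: algebra_simps)
  finally show ?thesis by simp
qed

text \<open>What the pending value loses is what the push adds to the accumulator. Their sum is
  therefore invariant, whatever the order of the pushes.\<close>

lemma value_push_eq:
  assumes k: "k < K" and u: "u < n"
    and upd: "\<And>j x. x < n \<Longrightarrow> residual s' j x = residual s j x + push_delta W v k u j x"
  shows "(\<Sum>j\<le>K. \<Sum>x<n. residual s' j x * val_layer j x)
    = (\<Sum>j\<le>K. \<Sum>x<n. residual s j x * val_layer j x) - v * t $ u"
proof -
  have "(\<Sum>j\<le>K. \<Sum>x<n. residual s' j x * val_layer j x)
     = (\<Sum>j\<le>K. \<Sum>x<n. (residual s j x + push_delta W v k u j x) * val_layer j x)"
    using upd by simp
  also have "\<dots> = (\<Sum>j\<le>K. \<Sum>x<n. residual s j x * val_layer j x)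
     + (\<Sum>j\<le>K. \<Sum>x<n. push_delta W v k u j x * val_layer j x)"
    by (simp add: distrib_right sum.distrib)
  also have "(\<Sum>j\<le>K. \<Sum>x<n. push_delta W v k u j x * val_layer j x) = - (v * t $ u)"
    unfolding sum_push_delta[OF k u] by (simp add: algebra_simps)
  finally show ?thesis by simp
qed

definition stack_valid :: "nat \<Rightarrow> state \<Rightarrow> bool" where
  "stack_valid K s \<longleftrightarrow> (\<forall>p<nreg s 3. narr s 0 p < n \<and> (\<exists>k\<le>K. narr s 1 p = k * n))"

text \<open>Only this direction is maintained: the stack may also contain pairs whose residual is
  small. Layer 0 is exempt, since residuals there are worth nothing.\<close>

definition stack_complete :: "nat \<Rightarrow> real \<Rightarrow> state \<Rightarrow> bool" where
  "stack_complete K \<theta> s \<longleftrightarrow> (\<forall>k u. 0 < k \<longrightarrow> k \<le> K \<longrightarrow> u < n \<longrightarrow> \<theta> < \<bar>residual s k u\<bar> \<longrightarrow>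
     (\<exists>p<nreg s 3. narr s 0 p = u \<and> narr s 1 p = k * n))"

definition potential :: "nat \<Rightarrow> state \<Rightarrow> real" where
  "potential K s = (\<Sum>k\<le>K. \<Sum>u<n. \<bar>residual s k u\<bar> * cost_layer k u)"

definition pending :: "nat \<Rightarrow> state \<Rightarrow> real" where
  "pending K s = (\<Sum>k\<le>K. \<Sum>u<n. residual s k u * val_layer k u)"

lemma potential_nonneg: "0 \<le> potential K s"
  unfolding potential_def using cost_layer_nonneg by (intro sum_nonneg mult_nonneg_nonneg) auto

text \<open>Discarding an entry takes four commands, the test of the conditional,
  \<open>Skip\<close> and the test of the loop, which is 7 per stack entry. A push takes at most 13
  + 8 \<open>deg u\<close> and lengthens the stack by \<open>deg u\<close> - 1; with
  \<open>1 \<le> deg u\<close> the total 6 + 15 \<open>deg u\<close> is at most 21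
  \<open>deg u\<close>, and the potential falls by at least \<open>\<theta> * deg u\<close>.\<close>

lemma wp_pop_body:
  assumes \<theta>: "0 < \<theta>" and s: "nreg s 0 = n" "rreg s 5 = \<theta> * \<theta>" "0 < nreg s 3"
    and valid: "stack_valid K s" and complete: "stack_complete K \<theta> s"
  shows "wp A pop_body (\<lambda>c s'. (nreg s' 0 = n \<and> rreg s' 5 = \<theta> * \<theta> \<and> stack_valid K s' \<and> stack_complete K \<theta> s'
       \<and> rreg s' 4 + pending K s' = rreg s 4 + pending K s)
     \<and> real c + 1 + (7 * real (nreg s' 3) + 21 * potential K s' / \<theta>)
       \<le> 7 * real (nreg s 3) + 21 * potential K s / \<theta>) s"
proof -
  define j where "j = nreg s 3 - 1"
  have j: "nreg s 3 = Suc j" using s by (simp add: j_def)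
  define u where "u = narr s 0 j"
  obtain k where u: "u < n" and k: "k \<le> K" "narr s 1 j = k * n"
    using valid j by (auto simp: stack_valid_def u_def)
  define v where "v = residual s k u"
  let ?is = "acc_cols A u"
  have set_is: "set ?is = {i. i < n \<and> M $$ (i, u) \<noteq> 0}" using cols[OF u] by auto
  have prep: "wp A pop_prepare (\<lambda>c s1. c = 4 \<and> nreg s1 0 = n \<and> nreg s1 3 = j \<and> nreg s1 4 = u
     \<and> nreg s1 8 = k * n \<and> rreg s1 4 = rreg s 4 \<and> rreg s1 5 = \<theta> * \<theta> \<and> rreg s1 6 = v
     \<and> narr s1 = narr s \<and> rarr s1 = rarr s) s"
    unfolding pop_prepare_def
    apply (intro wp_Seq wp_NSet wp_RSet)
    using s j k by (simp add: set_defs u_def v_def)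
  show ?thesis unfolding pop_body_def
  proof (rule wp_Seq, rule wp_mono[OF prep], elim conjE, rule wp_Cond)
    fix c :: nat and s1 :: state
    assume c: "c = 4" and s1: "nreg s1 0 = n" "nreg s1 3 = j" "nreg s1 4 = u" "nreg s1 8 = k * n"
      "rreg s1 4 = rreg s 4" "rreg s1 5 = \<theta> * \<theta>" "rreg s1 6 = v" "narr s1 = narr s" "rarr s1 = rarr s"
      and b: "bval (BAnd (NLess (NConst 0) (NReg 8)) (RLess (RReg 5) (RMul (RReg 6) (RReg 6)))) s1"
    from b s1 obtain k' where k': "k = Suc k'" by (cases k) auto
    have "\<theta>\<^sup>2 < v\<^sup>2" using b s1 by (simp add: power2_eq_square)
    hence v\<theta>: "\<theta> < \<bar>v\<bar>" using \<theta> by (metis abs_le_square_iff abs_of_pos not_less)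
    have push: "wp A push (\<lambda>c s'. real c \<le> 7 + 8 * deg u
     \<and> nreg s' 0 = n \<and> nreg s' 3 = j + length ?is
     \<and> rreg s' 4 = rreg s 4 + v * t $ u \<and> rreg s' 5 = \<theta> * \<theta>
     \<and> (\<forall>p<j. narr s' 0 p = narr s 0 p \<and> narr s' 1 p = narr s 1 p)
     \<and> (\<forall>q<length ?is. narr s' 0 (j + q) = ?is ! (length ?is - 1 - q) \<and> narr s' 1 (j + q) = k' * n)
     \<and> (\<forall>j. \<forall>x<n. residual s' j x = residual s j x + push_delta W v k' u j x)) s1"
      using wp_push[of s1 u k'] s1 k' u by (simp add: v_def)
    show "wp A push (\<lambda>l s'. (nreg s' 0 = n \<and> rreg s' 5 = \<theta> * \<theta> \<and> stack_valid K s' \<and> stack_complete K \<theta> s'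
       \<and> rreg s' 4 + pending K s' = rreg s 4 + pending K s)
     \<and> real (c + (1 + l)) + 1 + (7 * real (nreg s' 3) + 21 * potential K s' / \<theta>)
       \<le> 7 * real (nreg s 3) + 21 * potential K s / \<theta>) s1"
    proof (rule wp_mono[OF push], elim conjE, intro conjI)
      fix l :: nat and s' :: state
      assume l: "real l \<le> 7 + 8 * deg u" and s': "nreg s' 0 = n" "nreg s' 3 = j + length ?is"
        "rreg s' 4 = rreg s 4 + v * t $ u" "rreg s' 5 = \<theta> * \<theta>"
        and old: "\<forall>p<j. narr s' 0 p = narr s 0 p \<and> narr s' 1 p = narr s 1 p"
        and new: "\<forall>q<length ?is. narr s' 0 (j + q) = ?is ! (length ?is - 1 - q) \<and> narr s' 1 (j + q) = k' * n"
        and R: "\<forall>j. \<forall>x<n. residual s' j x = residual s j x + push_delta W v k' u j x"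
      show "nreg s' 0 = n" "rreg s' 5 = \<theta> * \<theta>" by fact+
      show "stack_valid K s'" unfolding stack_valid_def
      proof (intro allI impI)
        fix p assume p: "p < nreg s' 3"
        show "narr s' 0 p < n \<and> (\<exists>k\<le>K. narr s' 1 p = k * n)"
        proof (cases "p < j")
          case True
          thus ?thesis using old valid j by (simp add: stack_valid_def)
        next
          case False
          define q where "q = p - j"
          have q: "p = j + q" "q < length ?is" using False p s' by (auto simp: q_def)
          hence "?is ! (length ?is - 1 - q) \<in> set ?is" by (intro nth_mem) auto
          thus ?thesis using new q k k' set_is by auto
        qed
      qed
      show "stack_complete K \<theta> s'" unfolding stack_complete_def
      proof (intro allI impI)
        fix m x assume m: "0 < m" "m \<le> K" and x: "x < n" and gt: "\<theta> < \<bar>residual s' m x\<bar>"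
        show "\<exists>p<nreg s' 3. narr s' 0 p = x \<and> narr s' 1 p = m * n"
        \<comment> \<open>Residuals that may have grown belong to the column just stacked. All
          others are unchanged, except the pushed one, which is now 0.\<close>
        proof (cases "m = k' \<and> x \<in> set ?is")
          case True
          then obtain i where i: "i < length ?is" "?is ! i = x" by (metis in_set_conv_nth)
          have "narr s' 0 (j + (length ?is - 1 - i)) = x \<and> narr s' 1 (j + (length ?is - 1 - i)) = m * n"
            using new[rule_format, of "length ?is - 1 - i"] i True by simp
          moreover have "j + (length ?is - 1 - i) < nreg s' 3" using s' i by simp
          ultimately show ?thesis by blast
        next
          case False
          have ne: "\<not> (m = Suc k' \<and> x = u)"
          proof
            assume "m = Suc k' \<and> x = u"
            hence "residual s' m x = 0" using R[rule_format, OF u, of "Suc k'"] by (simp add: push_delta_def v_def k')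
            thus False using gt \<theta> by simp
          qed
          have "push_delta W v k' u m x = 0"
          proof (cases "m = k'")
            case True
            hence "M $$ (x, u) = 0" using False set_is x by auto
            \<comment> \<open>Node \<open>u\<close> occurs in its own column, so the identity part
              of the walk cannot touch a node outside it.\<close>
            moreover have "x \<noteq> u" using calculation diag[OF u] by auto
            ultimately show ?thesis using True by (simp add: push_delta_def walk_def)
          next
            case False
            thus ?thesis using ne by (simp add: push_delta_def)
          qed
          hence "\<theta> < \<bar>residual s m x\<bar>" using gt R x by simp
          then obtain p where p: "p < nreg s 3" "narr s 0 p = x" "narr s 1 p = m * n"
            using complete m x by (auto simp: stack_complete_def)
          \<comment> \<open>The popped position is the only one lost, and the residual it referred
            to has just been cleared.\<close>
          have "p \<noteq> j"
          proof
            assume "p = j"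
            hence "x = u" "m * n = k * n" using p k by (auto simp: u_def)
            hence "x = u" "m = k" using u by auto
            thus False using ne k' by simp
          qed
          hence "p < j" using p j by simp
          thus ?thesis using old p s' by (intro exI[of _ p]) auto
        qed
      qed
      have k'K: "k' < K" using k k' by simp
      have "pending K s' = pending K s - v * t $ u"
        unfolding pending_def using R by (intro value_push_eq[OF k'K u]) auto
      thus "rreg s' 4 + pending K s' = rreg s 4 + pending K s" using s' by simp
      have "potential K s' \<le> potential K s - \<bar>v\<bar> * deg u"
        unfolding potential_def using R by (intro potential_push_le[OF k'K u]) (auto simp: v_def k')
      also have "\<dots> \<le> potential K s - \<theta> * deg u"
        using v\<theta> by (intro diff_left_mono mult_right_mono) auto
      finally have "potential K s' / \<theta> \<le> (potential K s - \<theta> * deg u) / \<theta>"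
        using \<theta> by (intro divide_right_mono) auto
      hence "potential K s' / \<theta> \<le> potential K s / \<theta> - deg u" using \<theta> by (simp add: diff_divide_distrib)
      hence "21 * potential K s' / \<theta> \<le> 21 * potential K s / \<theta> - 21 * deg u" by simp
      thus "real (c + (1 + l)) + 1 + (7 * real (nreg s' 3) + 21 * potential K s' / \<theta>)
         \<le> 7 * real (nreg s 3) + 21 * potential K s / \<theta>"
        using l c s' j deg_ge_1[OF u] by simp
    qed
  next
    fix c :: nat and s1 :: state
    assume c: "c = 4" and s1: "nreg s1 0 = n" "nreg s1 3 = j" "nreg s1 4 = u" "nreg s1 8 = k * n"
      "rreg s1 4 = rreg s 4" "rreg s1 5 = \<theta> * \<theta>" "rreg s1 6 = v" "narr s1 = narr s" "rarr s1 = rarr s"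
      and b: "\<not> bval (BAnd (NLess (NConst 0) (NReg 8)) (RLess (RReg 5) (RMul (RReg 6) (RReg 6)))) s1"
    have small: "\<bar>v\<bar> \<le> \<theta>" if "0 < k"
    proof -
      have "v\<^sup>2 \<le> \<theta>\<^sup>2" using b s1 that u by (auto simp: power2_eq_square not_less)
      thus ?thesis using \<theta> by (metis abs_le_square_iff abs_of_pos)
    qed
    show "wp A Skip (\<lambda>l s'. (nreg s' 0 = n \<and> rreg s' 5 = \<theta> * \<theta> \<and> stack_valid K s' \<and> stack_complete K \<theta> s'
       \<and> rreg s' 4 + pending K s' = rreg s 4 + pending K s)
     \<and> real (c + (1 + l)) + 1 + (7 * real (nreg s' 3) + 21 * potential K s' / \<theta>)
       \<le> 7 * real (nreg s 3) + 21 * potential K s / \<theta>) s1"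
    proof (rule wp_Skip, intro conjI)
      show "nreg s1 0 = n" "rreg s1 5 = \<theta> * \<theta>" by fact+
      show "stack_valid K s1" using valid s1 j by (simp add: stack_valid_def)
      show "stack_complete K \<theta> s1" unfolding stack_complete_def
      proof (intro allI impI)
        fix m x assume m: "0 < m" "m \<le> K" and x: "x < n" and gt: "\<theta> < \<bar>residual s1 m x\<bar>"
        then obtain p where p: "p < nreg s 3" "narr s 0 p = x" "narr s 1 p = m * n"
          using complete s1 by (auto simp: stack_complete_def)
        have "p \<noteq> j"
        proof
          assume "p = j"
          hence "x = u" "m * n = k * n" using p k by (auto simp: u_def)
          hence "x = u" "m = k" using u by auto
          thus False using small gt s1 m by (simp add: v_def)
        qed
        thus "\<exists>p<nreg s1 3. narr s1 0 p = x \<and> narr s1 1 p = m * n"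
          using p j s1 by (intro exI[of _ p]) auto
      qed
      show "rreg s1 4 + pending K s1 = rreg s 4 + pending K s" using s1 by (simp add: pending_def)
      show "real (c + (1 + 1)) + 1 + (7 * real (nreg s1 3) + 21 * potential K s1 / \<theta>)
         \<le> 7 * real (nreg s 3) + 21 * potential K s / \<theta>"
        using s1 c j by (simp add: potential_def)
    qed
  qed
qed

text \<open>With an empty stack, completeness says that every residual with a layer left is at most
  \<open>\<theta>\<close>. Layer k then holds pending value at most
  \<open>\<theta> * k * l1_norm t\<close>, and the layers are summed.\<close>

lemma wp_push_all:
  assumes \<theta>: "0 < \<theta>" and s: "nreg s 0 = n" "rreg s 5 = \<theta> * \<theta>"
    and valid: "stack_valid K s" and complete: "stack_complete K \<theta> s"
  shows "wp A push_all (\<lambda>c s'. real c \<le> 1 + 7 * real (nreg s 3) + 21 * potential K s / \<theta>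
    \<and> \<bar>rreg s' 4 - (rreg s 4 + pending K s)\<bar> \<le> \<theta> * (real K * (real K + 1) / 2) * l1_norm t) s"
  unfolding push_all_def
proof (rule wp_While[where Inv = "\<lambda>s'. nreg s' 0 = n \<and> rreg s' 5 = \<theta> * \<theta> \<and> stack_valid K s'
      \<and> stack_complete K \<theta> s' \<and> rreg s' 4 + pending K s' = rreg s 4 + pending K s"
    and E = "\<lambda>s. 7 * real (nreg s 3) + 21 * potential K s / \<theta>"], goal_cases)
  case 1
  show ?case using assms by simp
next
  case (2 s')
  thus ?case using wp_pop_body[OF \<theta>, of s' K] by simp
next
  case (3 s')
  show ?case using potential_nonneg[of K s'] \<theta> by (intro add_nonneg_nonneg divide_nonneg_nonneg) auto
next
  case (4 c s')
  have small: "\<bar>residual s' k u\<bar> \<le> \<theta>" if "0 < k" "k \<le> K" "u < n" for k u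
  proof (rule ccontr)
    assume "\<not> \<bar>residual s' k u\<bar> \<le> \<theta>"
    hence "\<exists>p<nreg s' 3. narr s' 0 p = u \<and> narr s' 1 p = k * n"
      using 4(1) that unfolding stack_complete_def by (meson not_le)
    thus False using 4(2) by simp
  qed
  have "\<bar>pending K s'\<bar> \<le> (\<Sum>k\<le>K. \<bar>\<Sum>u<n. residual s' k u * val_layer k u\<bar>)"
    unfolding pending_def by (rule sum_abs)
  also have "\<dots> \<le> (\<Sum>k\<le>K. \<theta> * (real k * l1_norm t))"
  proof (rule sum_mono)
    fix k assume k: "k \<in> {..K}"
    show "\<bar>\<Sum>u<n. residual s' k u * val_layer k u\<bar> \<le> \<theta> * (real k * l1_norm t)"
    proof (cases "k = 0")
      case False
      have "\<bar>\<Sum>u<n. residual s' k u * val_layer k u\<bar> \<le> (\<Sum>u<n. \<bar>residual s' k u * val_layer k u\<bar>)"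
        by (rule sum_abs)
      also have "\<dots> \<le> (\<Sum>u<n. \<theta> * \<bar>val_layer k u\<bar>)"
        unfolding abs_mult using small False k by (intro sum_mono mult_right_mono) auto
      also have "\<dots> \<le> \<theta> * (real k * (\<Sum>u<n. \<bar>t $ u\<bar>))"
        unfolding sum_distrib_left[symmetric] using \<theta> by (intro mult_left_mono layer_sum_l1 walk_row_sum) auto
      finally show ?thesis by (simp add: l1_norm_def)
    qed simp
  qed
  also have "\<dots> = \<theta> * ((\<Sum>k\<le>K. real k) * l1_norm t)"
    by (simp add: sum_distrib_left sum_distrib_right)
  also have "(\<Sum>k\<le>K. real k) = real K * (real K + 1) / 2"
    by (induction K) (simp_all add: field_simps)
  finally have "\<bar>pending K s'\<bar> \<le> \<theta> * (real K * (real K + 1) / 2) * l1_norm t" by (simp add: mult.assoc)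
  moreover have "rreg s' 4 - (rreg s 4 + pending K s) = - pending K s'" using 4 by linarith
  hence "\<bar>rreg s' 4 - (rreg s 4 + pending K s)\<bar> = \<bar>pending K s'\<bar>" by (simp only: abs_minus_cancel)
  ultimately show ?case using 4 by linarith
qed

section \<open>Phases of the program\<close>

lemma wp_count_layers:
  assumes s: "nreg s 0 = n" "nreg s 2 = 0" "nreg s 7 = 0" "rreg s 3 = B" and B: "0 < B"
  shows "wp A count_layers (\<lambda>c s'. real c \<le> 4 + 3 * B \<and> nreg s' 0 = n \<and> nreg s' 1 = nreg s 1
     \<and> nreg s' 2 = nat \<lceil>B\<rceil> * n \<and> rreg s' = rreg s \<and> rarr s' = rarr s) s"
  unfolding count_layers_def
proof (rule wp_While[where Inv = "\<lambda>s'. nreg s' 0 = n \<and> nreg s' 1 = nreg s 1 \<and> nreg s' 2 = nreg s' 7 * n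
     \<and> real (nreg s' 7) < B + 1 \<and> rreg s' = rreg s \<and> rarr s' = rarr s"
    and E = "\<lambda>s'. 3 * (B + 1 - real (nreg s' 7))"], goal_cases)
  case 1
  show ?case using s B by simp
next
  case (2 s')
  show ?case
    apply (intro wp_Seq wp_NSet)
    using 2 s by (simp add: set_defs)
next
  case (4 c s')
  \<comment> \<open>The failed guard says that the count is at least \<open>B\<close>, the invariant
    that it is below \<open>B + 1\<close>.\<close>
  have "\<lceil>B\<rceil> = int (nreg s' 7)" using 4 s by (intro ceiling_unique) auto
  hence "nreg s' 7 = nat \<lceil>B\<rceil>" by simp
  thus ?case using 4 s by simp
qed auto

lemma wp_init_push:
  assumes s: "nreg s 0 = n" "nreg s 1 = w" "nreg s 2 = K * n" "rreg s 0 = \<epsilon>" "rreg s 3 = B" "rreg s 4 = 0"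
    "rarr s = (\<lambda>_ _. 0)" and w: "w < n"
  defines "\<theta> \<equiv> \<epsilon> / (B * B * M $$ (w, w))"
  shows "wp A init_push (\<lambda>c s'. c = 7 \<and> nreg s' 0 = n \<and> nreg s' 3 = 1 \<and> narr s' 0 0 = w
     \<and> narr s' 1 0 = K * n \<and> rreg s' 4 = 0 \<and> rreg s' 5 = \<theta> * \<theta>
     \<and> rarr s' 0 = (\<lambda>_. 0)(K * n + w := 1 / M $$ (w, w))) s"
  unfolding init_push_def
  apply (intro wp_Seq wp_NSet wp_RSet wp_LoadDiag wp_NStore wp_RStore)
  using s w by (simp_all add: set_defs \<theta>_def)

lemma wp_push_phase:
  assumes s: "nreg s 0 = n" "nreg s 1 = w" "nreg s 2 = 0" "nreg s 7 = 0" "rreg s 0 = \<epsilon>" "rreg s 3 = B"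
    "rreg s 4 = 0" "rarr s = (\<lambda>_ _. 0)"
    and w: "w < n" and \<epsilon>: "0 < \<epsilon>" and B: "0 < B"
  defines "K \<equiv> nat \<lceil>B\<rceil>"
  shows "wp A push_phase
     (\<lambda>c s'. real c \<le> 20 + 3 * B + 21 * (B\<^sup>2 / \<epsilon>) * cost_layer K w
       \<and> \<bar>rreg s' 0 - val_layer K w / (2 * M $$ (w, w))\<bar>
          \<le> \<epsilon> / (B\<^sup>2 * M $$ (w, w)) * (real K * (real K + 1) / 4) * l1_norm t) s"
proof -
  let ?d = "M $$ (w, w)"
  define \<theta> where "\<theta> = \<epsilon> / (B * B * ?d)"
  have d: "0 < ?d" by (rule diag[OF w])
  have \<theta>: "0 < \<theta>" using \<epsilon> B d by (simp add: \<theta>_def)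
  show ?thesis unfolding push_phase_def
  proof (rule wp_Seq, rule wp_mono[OF wp_count_layers[OF s(1,3,4,6) B]], elim conjE)
    fix c1 :: nat and s1 :: state
    assume c1: "real c1 \<le> 4 + 3 * B" and s1: "nreg s1 0 = n" "nreg s1 1 = nreg s 1" "nreg s1 2 = nat \<lceil>B\<rceil> * n"
      "rreg s1 = rreg s" "rarr s1 = rarr s"
    have init: "wp A init_push (\<lambda>c s'. c = 7 \<and> nreg s' 0 = n \<and> nreg s' 3 = 1 \<and> narr s' 0 0 = w
     \<and> narr s' 1 0 = K * n \<and> rreg s' 4 = 0 \<and> rreg s' 5 = \<theta> * \<theta>
     \<and> rarr s' 0 = (\<lambda>_. 0)(K * n + w := 1 / ?d)) s1"
      unfolding \<theta>_def using s s1 w by (intro wp_init_push) (auto simp: K_def)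
    show "wp A (Seq init_push (Seq push_all (RSet 0 (RDiv (RReg 4) (ROfNat (NConst 2))))))
     (\<lambda>l s'. real (c1 + l) \<le> 20 + 3 * B + 21 * (B\<^sup>2 / \<epsilon>) * cost_layer K w
       \<and> \<bar>rreg s' 0 - val_layer K w / (2 * M $$ (w, w))\<bar>
          \<le> \<epsilon> / (B\<^sup>2 * M $$ (w, w)) * (real K * (real K + 1) / 4) * l1_norm t) s1"
    proof (rule wp_Seq, rule wp_mono[OF init], elim conjE)
      fix c2 :: nat and s2 :: state
      assume c2: "c2 = 7" and s2: "nreg s2 0 = n" "nreg s2 3 = 1" "narr s2 0 0 = w"
        "narr s2 1 0 = K * n" "rreg s2 4 = 0" "rreg s2 5 = \<theta> * \<theta>"
        "rarr s2 0 = (\<lambda>_. 0)(K * n + w := 1 / ?d)"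
      have res: "residual s2 k u = (if k = K \<and> u = w then 1 / ?d else 0)" if "u < n" for k u
        using layer_index_inj[OF that w, of k K] s2 by simp
      have sum_res: "(\<Sum>k\<le>K. \<Sum>u<n. (if k = K \<and> u = w then 1 / ?d else 0) * F k u) = F K w / ?d" for F :: "nat \<Rightarrow> nat \<Rightarrow> real"
      proof -
        have "(\<Sum>u<n. (if k = K \<and> u = w then 1 / ?d else 0) * F k u) = (if k = K then F K w / ?d else 0)" for k
        proof -
          have "(\<Sum>u<n. (if k = K \<and> u = w then 1 / ?d else 0) * F k u)
              = (\<Sum>u<n. if u = w then if k = K then F K w / ?d else 0 else 0)"
            by (intro sum.cong) auto
          thus ?thesis using w by simp
        qed
        thus ?thesis by simp
      qed
      have pend: "pending K s2 = val_layer K w / ?d"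
        unfolding pending_def sum_res[symmetric] by (intro sum.cong) (auto simp: res)
      have "potential K s2 = cost_layer K w / ?d"
        unfolding potential_def sum_res[symmetric] using d by (intro sum.cong) (auto simp: res)
      \<comment> \<open>The diagonal entry in the starting residual cancels the one in
        \<open>\<theta>\<close>, so the work does not depend on the scale of the node
        \<open>w\<close>.\<close>
      hence pot: "potential K s2 / \<theta> = (B\<^sup>2 / \<epsilon>) * cost_layer K w"
        using d B \<epsilon> by (simp add: \<theta>_def field_simps power2_eq_square)
      have valid: "stack_valid K s2" using s2 w by (auto simp: stack_valid_def)
      have complete: "stack_complete K \<theta> s2" unfolding stack_complete_def
      proof (intro allI impI)
        fix k u assume "u < n" "\<theta> < \<bar>residual s2 k u\<bar>"
        hence "k = K \<and> u = w" using res \<theta> by (auto split: if_splits)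
        thus "\<exists>p<nreg s2 3. narr s2 0 p = u \<and> narr s2 1 p = k * n" using s2 by auto
      qed
      show "wp A (Seq push_all (RSet 0 (RDiv (RReg 4) (ROfNat (NConst 2)))))
       (\<lambda>l s'. real (c1 + (c2 + l)) \<le> 20 + 3 * B + 21 * (B\<^sup>2 / \<epsilon>) * cost_layer K w
         \<and> \<bar>rreg s' 0 - val_layer K w / (2 * M $$ (w, w))\<bar>
            \<le> \<epsilon> / (B\<^sup>2 * M $$ (w, w)) * (real K * (real K + 1) / 4) * l1_norm t) s2"
      proof (rule wp_Seq, rule wp_mono[OF wp_push_all[OF \<theta> s2(1,6) valid complete]], elim conjE, rule wp_RSet, intro conjI)
        fix c3 :: nat and s3 :: state
        assume c3: "real c3 \<le> 1 + 7 * real (nreg s2 3) + 21 * potential K s2 / \<theta>"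
        show "real (c1 + (c2 + (c3 + 1))) \<le> 20 + 3 * B + 21 * (B\<^sup>2 / \<epsilon>) * cost_layer K w"
          using c1 c2 c3 s2 pot by simp
      next
        fix s3 :: state
        assume e: "\<bar>rreg s3 4 - (rreg s2 4 + pending K s2)\<bar> \<le> \<theta> * (real K * (real K + 1) / 2) * l1_norm t"
        have "rreg s3 4 / 2 - val_layer K w / (2 * ?d) = (rreg s3 4 - (rreg s2 4 + pending K s2)) / 2"
          using pend s2 by (simp add: diff_divide_distrib)
        also have "\<bar>\<dots>\<bar> \<le> \<theta> * (real K * (real K + 1) / 2) * l1_norm t / 2"
          using e by simp
        finally show "\<bar>rreg (set_rreg 0 (rval (RDiv (RReg 4) (ROfNat (NConst 2))) s3) s3) 0 - val_layer K w / (2 * M $$ (w, w))\<bar>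
            \<le> \<epsilon> / (B\<^sup>2 * M $$ (w, w)) * (real K * (real K + 1) / 4) * l1_norm t"
          by (simp add: set_rreg_def \<theta>_def power2_eq_square)
      qed
    qed
  qed
qed

lemma wp_solver:
  fixes \<Lambda> :: real
  assumes w: "w < n" and \<epsilon>: "0 < \<epsilon>" and \<gamma>: "0 < \<gamma>"
  defines "B \<equiv> 6 * log1 \<Lambda> / \<gamma>"
  defines "K \<equiv> nat \<lceil>B\<rceil>"
  shows "wp A solver (\<lambda>c s'.
     if \<epsilon> < B then real c \<le> 30 + 3 * B + 21 * (B\<^sup>2 / \<epsilon>) * cost_layer K w
       \<and> \<bar>rreg s' 0 - val_layer K w / (2 * M $$ (w, w))\<bar>
          \<le> \<epsilon> / (B\<^sup>2 * M $$ (w, w)) * (real K * (real K + 1) / 4) * l1_norm t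
     else real c \<le> 30 \<and> rreg s' 0 = 0) (input_state n w \<epsilon> \<gamma> \<Lambda>)" (is "wp A solver ?Q ?s")
proof -
  have B: "0 < B" using \<gamma> by (auto simp: B_def log1_def)
  have prep: "wp A solver_prepare (\<lambda>c s. c = 4 \<and> nreg s 0 = n \<and> nreg s 1 = w \<and> nreg s 2 = 0
     \<and> nreg s 7 = 0 \<and> rreg s 0 = \<epsilon> \<and> rreg s 3 = B \<and> rreg s 4 = 0 \<and> rarr s = (\<lambda>_ _. 0)) ?s"
    unfolding solver_prepare_def B_def log1_def
    by (intro wp_Seq wp_RSet wp_Cond wp_Skip) (auto simp: set_defs input_state_def)
  show ?thesis unfolding solver_def
  proof (rule wp_Seq, rule wp_mono[OF prep], elim conjE, rule wp_Cond)
    fix c :: nat and s :: state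
    assume c: "c = 4" and s: "nreg s 0 = n" "nreg s 1 = w" "nreg s 2 = 0" "nreg s 7 = 0" "rreg s 0 = \<epsilon>"
      "rreg s 3 = B" "rreg s 4 = 0" "rarr s = (\<lambda>_ _. 0)" and b: "bval (RLess (RReg 0) (RReg 3)) s"
    show "wp A push_phase (\<lambda>k. ?Q (c + (1 + k))) s"
      by (rule wp_mono[OF wp_push_phase[OF s w \<epsilon> B, folded K_def]]) (use b c s in auto)
  next
    fix c :: nat and s :: state
    assume c: "c = 4" and s: "rreg s 0 = \<epsilon>" "rreg s 3 = B" and b: "\<not> bval (RLess (RReg 0) (RReg 3)) s"
    show "wp A (RSet 0 (ROfNat (NConst 0))) (\<lambda>k. ?Q (c + (1 + k))) s"
      by (rule wp_RSet) (use b c s in \<open>simp add: set_rreg_def\<close>)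
  qed
qed

section \<open>Work summed over all start nodes\<close>

lemma sum_cost_layer: "(\<Sum>w<n. cost_layer K w) \<le> real K * real (nnz M)"
proof -
  have "(\<Sum>w<n. cost_layer K w) \<le> (\<Sum>w<n. \<bar>cost_layer K w\<bar>)" by (intro sum_mono) auto
  \<comment> \<open>The average over \<open>w\<close> enters here: the row sums control the total of
    the costs, but no single one of them well.\<close>
  also have "\<dots> \<le> real K * (\<Sum>u<n. \<bar>deg u\<bar>)"
    using walk_row_sum by (intro layer_sum_l1) auto
  also have "(\<Sum>u<n. \<bar>deg u\<bar>) = real (nnz M)"
  proof -
    have "nnz M = card (\<Union>j<n. (\<lambda>i. (i, j)) ` set (acc_cols A j))"
      unfolding nnz_def using cols by (intro arg_cong[of _ _ card]) auto
    also have "\<dots> = (\<Sum>j<n. card ((\<lambda>i. (i, j)) ` set (acc_cols A j)))"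
      by (intro card_UN_disjoint) auto
    also have "\<dots> = (\<Sum>j<n. length (acc_cols A j))"
    proof (rule sum.cong)
      fix j assume "j \<in> {..<n}"
      hence "distinct (acc_cols A j)" using cols by blast
      thus "card ((\<lambda>i. (i, j)) ` set (acc_cols A j)) = length (acc_cols A j)"
        by (simp add: card_image inj_on_def distinct_card)
    qed simp
    finally show ?thesis by simp
  qed
  finally show ?thesis .
qed

text \<open>By the diagonal. It lets costs that every run incurs be multiplied by
  \<open>nnz M\<close> over n.\<close>

lemma nnz_ge: "n \<le> nnz M"
proof -
  have "card ((\<lambda>i. (i, i)) ` {..<n}) \<le> nnz M"
    unfolding nnz_def
  proof (rule card_mono)
    show "finite {(i, j). i < dim_row M \<and> j < dim_col M \<and> M $$ (i, j) \<noteq> 0}"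
      by (rule finite_subset[of _ "{..<n} \<times> {..<n}"]) auto
  qed (use diag in force)
  thus ?thesis by (simp add: card_image inj_on_def)
qed

section \<open>The truncated series as a layer sum\<close>

lemma walk_matrix_index:
  assumes "v \<in> carrier_vec n" "i < n"
  shows "(lazy (D_pow M (-1) * AT_part M) *\<^sub>v v) $ i = (\<Sum>j<n. W i j * v $ j)"
proof -
  have "(\<Sum>j<n. W i j * v $ j) = (\<Sum>j<n. (if j = i then v $ i else 0) - M $$ (i, j) * v $ j / (2 * M $$ (i, i)))"
    by (intro sum.cong) (auto simp: walk_def algebra_simps)
  also have "\<dots> = v $ i - (M *\<^sub>v v) $ i / (2 * M $$ (i, i))"
    unfolding sum_subtractf mult_vec_index[OF M assms] sum_divide_distrib using assms by simp
  finally show ?thesis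
    unfolding walk_matrix_mult_vec[OF M assms] AT_part_mult_vec[OF M assms]
    using diag[OF assms(2)] by (simp add: powr_minus field_simps)
qed

text \<open>Duality: the powers of the walk matrix move from \<open>v\<close> to \<open>t\<close>.
  Peeling off the factor next to \<open>v\<close> matches the recursion of \<open>layer_sum\<close>,
  which is why \<open>v\<close> is arbitrary in the induction.\<close>

lemma partial_sum_val_layer:
  assumes "v \<in> carrier_vec n"
  shows "(\<Sum>l<K. t \<bullet> ((lazy (D_pow M (-1) * AT_part M) ^\<^sub>m l) *\<^sub>v v)) = (\<Sum>u<n. val_layer K u * v $ u)"
  using assms
proof (induction K arbitrary: v)
  case (Suc K)
  let ?T = "lazy (D_pow M (-1) * AT_part M)"
  have T: "?T \<in> carrier_mat n n" by (rule walk_matrix_carrier[OF M])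
  have Tv: "?T *\<^sub>v v \<in> carrier_vec n" by (rule mult_mat_vec_carrier[OF T Suc.prems])
  have "(\<Sum>l<Suc K. t \<bullet> ((?T ^\<^sub>m l) *\<^sub>v v)) = t \<bullet> ((?T ^\<^sub>m 0) *\<^sub>v v) + (\<Sum>l<K. t \<bullet> ((?T ^\<^sub>m Suc l) *\<^sub>v v))"
    by (rule sum.lessThan_Suc_shift)
  also have "(?T ^\<^sub>m 0) *\<^sub>v v = v" using carrier_matD(1)[OF T] Suc.prems by simp
  also have "(\<Sum>l<K. t \<bullet> ((?T ^\<^sub>m Suc l) *\<^sub>v v)) = (\<Sum>l<K. t \<bullet> ((?T ^\<^sub>m l) *\<^sub>v (?T *\<^sub>v v)))"
    by (simp only: pow_mat_Suc_mult_vec[OF T Suc.prems])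
  also have "\<dots> = (\<Sum>r<n. val_layer K r * (?T *\<^sub>v v) $ r)" by (rule Suc.IH[OF Tv])
  also have "\<dots> = (\<Sum>r<n. \<Sum>u<n. val_layer K r * (W r u * v $ u))"
    by (intro sum.cong) (auto simp: walk_matrix_index[OF Suc.prems] sum_distrib_left)
  also have "\<dots> = (\<Sum>u<n. (\<Sum>r<n. W r u * val_layer K r) * v $ u)"
    by (subst sum.swap) (simp add: sum_distrib_left sum_distrib_right mult_ac)
  also have "t \<bullet> v = (\<Sum>u<n. t $ u * v $ u)"
    using Suc.prems by (simp add: scalar_prod_def atLeast0LessThan)
  finally show ?case by (simp add: distrib_right sum.distrib)
qed simp

lemma D_inv_unit_vec: "w < n \<Longrightarrow> D_pow M (-1) *\<^sub>v unit_vec n w = (1 / M $$ (w, w)) \<cdot>\<^sub>v unit_vec n w"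
proof (rule eq_vecI)
  fix i assume w: "w < n" and "i < dim_vec ((1 / M $$ (w, w)) \<cdot>\<^sub>v unit_vec n w)"
  hence i: "i < n" by simp
  have "(D_pow M (-1) *\<^sub>v unit_vec n w) $ i = M $$ (i, i) powr (-1) * unit_vec n w $ i"
    by (rule D_pow_mult_vec[OF M _ i]) simp
  thus "(D_pow M (-1) *\<^sub>v unit_vec n w) $ i = ((1 / M $$ (w, w)) \<cdot>\<^sub>v unit_vec n w) $ i"
    using i w diag[OF w] by (auto simp: unit_vec_def powr_minus divide_inverse)
qed (use D_pow_carrier[OF M, of "-1"] in auto)

lemma linf_D_inv_unit_vec:
  assumes "w < n"
  shows "linf_norm (D_pow M (-1) *\<^sub>v unit_vec n w) = 1 / M $$ (w, w)"
  using lp_norm_smult[of \<infinity> "unit_vec n w" "1 / M $$ (w, w)"] lp_norm_unit_vec[OF _ assms, of \<infinity>]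
    diag[OF assms] assms
  by (simp add: D_inv_unit_vec lp_norm_def)

lemma partial_sum_unit_vec:
  assumes w: "w < n"
  shows "(\<Sum>l<K. t \<bullet> ((lazy (D_pow M (-1) * AT_part M) ^\<^sub>m l) *\<^sub>v (D_pow M (-1) *\<^sub>v unit_vec n w)))
    = val_layer K w / M $$ (w, w)"
proof -
  have "(\<Sum>u<n. val_layer K u * (D_pow M (-1) *\<^sub>v unit_vec n w) $ u)
      = (\<Sum>u<n. if u = w then val_layer K w / M $$ (w, w) else 0)"
    unfolding D_inv_unit_vec[OF w] using w by (intro sum.cong) (auto simp: unit_vec_def)
  thus ?thesis using w mult_mat_vec_carrier[OF D_pow_carrier[OF M]]
    by (subst partial_sum_val_layer) auto
qed

text \<open>Bounds the error of the answer 0 for large \<open>\<epsilon>\<close>.\<close>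

lemma val_layer_le:
  assumes "w < n"
  shows "\<bar>val_layer K w\<bar> \<le> real K * l1_norm t"
proof -
  have "\<bar>val_layer K w\<bar> \<le> (\<Sum>u<n. \<bar>val_layer K u\<bar>)"
    using assms by (intro member_le_sum) auto
  also have "\<dots> \<le> real K * l1_norm t"
    unfolding l1_norm_def dims by (intro layer_sum_l1 walk_row_sum)
  finally show ?thesis .
qed

section \<open>Error budget and the logarithm\<close>

lemma log_argument_unit_vec:
  assumes w: "w < n"
  shows "log_argument M (unit_vec n w) t \<gamma> (target_accuracy M (unit_vec n w) t \<epsilon>)
    = d_max M * real (l0_norm t) * linf_norm (D_pow M (-1) *\<^sub>v t) / (\<gamma> * \<epsilon> * l1_norm t)"
proof -
  have "{i. i < dim_vec (unit_vec n w :: real vec) \<and> unit_vec n w $ i \<noteq> (0 :: real)} = {w}"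
    using w by (auto split: if_splits)
  hence l0: "l0_norm (unit_vec n w) = 1" by (simp add: l0_norm_def)
  show ?thesis
    unfolding log_argument_def target_accuracy_def linf_D_inv_unit_vec[OF w] l0
    using diag[OF w] by simp
qed

lemma l1_norm_pos: "t \<noteq> 0\<^sub>v n \<Longrightarrow> 0 < l1_norm t"
proof -
  assume "t \<noteq> 0\<^sub>v n"
  then obtain i where i: "i < n" "t $ i \<noteq> 0" using t by (metis carrier_vecD dim_vec index_zero_vec eq_vecI)
  hence "\<bar>t $ i\<bar> \<le> l1_norm t" unfolding l1_norm_def by (intro member_le_sum) auto
  thus ?thesis using i by linarith
qed

lemma truncation_le:
  assumes w: "w < n" and b: "unit_vec n w \<in> mat_range M" and \<gamma>: "0 < \<gamma>" "\<gamma> \<le> gamma_max M"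
    and \<epsilon>: "0 < \<epsilon>" and t0: "t \<noteq> 0\<^sub>v n"
    and \<Lambda>: "log_argument M (unit_vec n w) t \<gamma> (target_accuracy M (unit_vec n w) t \<epsilon>) \<le> \<Lambda>"
    and K: "6 * log1 \<Lambda> / \<gamma> \<le> real K"
  shows "\<bar>t \<bullet> x_star M (unit_vec n w) - val_layer K w / (2 * M $$ (w, w))\<bar>
     \<le> \<epsilon> / 4 * (l1_norm t / M $$ (w, w))"
proof -
  define X where "X = d_max M * real (l0_norm t) * linf_norm (D_pow M (-1) *\<^sub>v t) / (\<gamma> * \<epsilon> * l1_norm t)"
  have l1: "0 < l1_norm t" by (rule l1_norm_pos[OF t0])
  have d: "0 < M $$ (w, w)" by (rule diag[OF w])
  have X\<Lambda>: "X \<le> \<Lambda>" using \<Lambda> unfolding log_argument_unit_vec[OF w] X_def .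
  have "\<bar>t \<bullet> x_star M (unit_vec n w) - 1/2 * (val_layer K w / M $$ (w, w))\<bar>
      \<le> (1 - \<gamma> / 2) ^ K / \<gamma> * (d_max M * real (l0_norm t) * linf_norm (D_pow M (-1) *\<^sub>v t)) / M $$ (w, w)"
    using x_star_tail[OF M rdd \<gamma> w b t, of K] unfolding partial_sum_unit_vec[OF w] .
  \<comment> \<open>The argument of the logarithm is the constant of the tail bound divided by the
    target accuracy, so it remains to make \<open>(1 - \<gamma> / 2) ^ K\<close> small against 1 /
    \<open>X\<close>.\<close>
  also have "\<dots> = ((1 - \<gamma> / 2) ^ K * X) * \<epsilon> * (l1_norm t / M $$ (w, w))"
    using \<gamma> \<epsilon> l1 d by (simp add: X_def field_simps)
  also have "\<dots> \<le> (1 / 4) * \<epsilon> * (l1_norm t / M $$ (w, w))"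
  proof (intro mult_right_mono)
    have "0 \<le> 1 - \<gamma> / 2" using \<gamma> gamma_max_le_1[OF M] w by simp
    show "(1 - \<gamma> / 2) ^ K * X \<le> 1 / 4"
    proof (cases "0 < X")
      case True
      have "(1 - \<gamma> / 2) ^ K \<le> exp (- (\<gamma> / 2)) ^ K"
        using \<open>0 \<le> 1 - \<gamma> / 2\<close> exp_ge_add_one_self[of "- (\<gamma> / 2)"] by (intro power_mono) auto
      also have "\<dots> = exp (- (real K * (\<gamma> / 2)))" by (simp add: exp_of_nat_mult[symmetric])
      also have "\<dots> \<le> exp (- (ln X + 2))"
      proof -
        \<comment> \<open>Origin of the 6: half of it is lost to the rate \<gamma> / 2. Of the
          remaining three copies of \<open>log1 \<Lambda>\<close> one dominates \<open>ln X\<close>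
          and the other two are at least 2, which yields the quarter through exp (-2).\<close>
        have "6 * log1 \<Lambda> \<le> real K * \<gamma>" using K \<gamma> by (simp add: field_simps)
        moreover have "ln X \<le> ln \<Lambda>" using True X\<Lambda> by simp
        ultimately have "ln X + 2 \<le> real K * (\<gamma> / 2)" by (simp add: log1_def)
        thus ?thesis by simp
      qed
      also have "\<dots> = exp (-2) / X" using True by (simp add: exp_diff exp_minus field_simps exp_add)
      also have "exp (-2 :: real) \<le> 1 / 4"
      proof -
        have "(2::real) ^ 2 \<le> exp 1 ^ 2" using exp_ge_add_one_self[of 1] by (intro power_mono) auto
        also have "exp (1::real) ^ 2 = exp 2" by (simp add: exp_of_nat_mult[symmetric])
        finally show ?thesis by (simp add: exp_minus field_simps)
      qed
      finally show ?thesis using True by (simp add: field_simps divide_right_mono)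
    next
      case False
      hence "(1 - \<gamma> / 2) ^ K * X \<le> 0" using \<open>0 \<le> 1 - \<gamma> / 2\<close> by (intro mult_nonneg_nonpos) auto
      thus ?thesis by simp
    qed
  qed (use \<epsilon> l1 d in auto)
  finally show ?thesis by (simp add: mult_ac)
qed

text \<open>The time is stated through \<open>Bs\<close> instead of the bound of the individual run,
  so that the right-hand sides can be summed over \<open>w\<close>.\<close>

lemma solver_correct:
  assumes w: "w < n" and \<gamma>: "0 < \<gamma>" "\<gamma> \<le> gamma_max M" and \<epsilon>: "0 < \<epsilon>" and t0: "t \<noteq> 0\<^sub>v n"
    and \<Lambda>: "log_argument M (unit_vec n w) t \<gamma> (target_accuracy M (unit_vec n w) t \<epsilon>) \<le> \<Lambda>"
    and Bs: "6 * log1 \<Lambda> / \<gamma> \<le> Bs"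
  shows "\<exists>k y. computes solver A (input_state n w \<epsilon> \<gamma> \<Lambda>) k y
    \<and> (unit_vec n w \<in> mat_range M \<longrightarrow> \<bar>y - t \<bullet> x_star M (unit_vec n w)\<bar> 
        \<le> \<epsilon> * l1_norm t * linf_norm (D_pow M (-1) *\<^sub>v unit_vec n w))
    \<and> real k \<le> 30 + 3 * (Bs ^ 3 / \<epsilon>) + 21 * (Bs\<^sup>2 / \<epsilon>) * cost_layer (nat \<lceil>Bs\<rceil>) w"
proof -
  define B where "B = 6 * log1 \<Lambda> / \<gamma>"
  define K where "K = nat \<lceil>B\<rceil>"
  have \<gamma>1: "\<gamma> \<le> 1" using \<gamma> gamma_max_le_1[OF M] w by simp
  have "6 * 1 / 1 \<le> B" unfolding B_def using \<gamma> \<gamma>1 by (intro frac_le mult_left_mono) (auto simp: log1_def)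
  hence B6: "6 \<le> B" by simp
  have BBs: "B \<le> Bs" using Bs by (simp add: B_def)
  have K: "B \<le> real K" "real K \<le> B + 1" using B6 by (auto simp: K_def)
  have d: "0 < M $$ (w, w)" by (rule diag[OF w])
  have l1: "0 < l1_norm t" by (rule l1_norm_pos[OF t0])
  define Y where "Y = l1_norm t / M $$ (w, w)"
  have Y: "0 < Y" using d l1 by (simp add: Y_def)
  have target: "\<epsilon> * l1_norm t * linf_norm (D_pow M (-1) *\<^sub>v unit_vec n w) = \<epsilon> * Y"
    by (simp add: linf_D_inv_unit_vec[OF w] Y_def)
  have trunc: "\<bar>t \<bullet> x_star M (unit_vec n w) - val_layer K w / (2 * M $$ (w, w))\<bar> \<le> \<epsilon> / 4 * Y"
    if "unit_vec n w \<in> mat_range M"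
    using truncation_le[OF w that \<gamma> \<epsilon> t0 \<Lambda>, of K] K by (simp add: B_def Y_def)
  have Bs0: "0 \<le> 3 * (Bs ^ 3 / \<epsilon>)" "0 \<le> 21 * (Bs\<^sup>2 / \<epsilon>) * cost_layer (nat \<lceil>Bs\<rceil>) w"
    using BBs B6 \<epsilon> cost_layer_nonneg[OF w] by auto
  obtain k s where ex: "exec A solver (input_state n w \<epsilon> \<gamma> \<Lambda>) k s"
    and post: "if \<epsilon> < B then real k \<le> 30 + 3 * B + 21 * (B\<^sup>2 / \<epsilon>) * cost_layer K w
       \<and> \<bar>rreg s 0 - val_layer K w / (2 * M $$ (w, w))\<bar>
          \<le> \<epsilon> / (B\<^sup>2 * M $$ (w, w)) * (real K * (real K + 1) / 4) * l1_norm t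
     else real k \<le> 30 \<and> rreg s 0 = 0"
    using wp_solver[OF w \<epsilon> \<gamma>(1), of \<Lambda>] unfolding wp_def B_def[symmetric] K_def[symmetric] by blast
  have acc: "\<bar>rreg s 0 - t \<bullet> x_star M (unit_vec n w)\<bar> \<le> \<epsilon> * Y" if b: "unit_vec n w \<in> mat_range M"
  proof (cases "\<epsilon> < B")
    case True
    have "real K * (real K + 1) \<le> (B + 1) * (B + 2)" using K B6 by (intro mult_mono) auto
    \<comment> \<open>The difference of the two sides factors as
      \<open>(2 * B + 1) * (B - 2)\<close>.\<close>
    also have "\<dots> \<le> 3 * B\<^sup>2"
    proof -
      have "0 \<le> (2 * B + 1) * (B - 2)" using B6 by (intro mult_nonneg_nonneg) auto
      thus ?thesis by (simp add: power2_eq_square algebra_simps)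
    qed
    finally have KK: "real K * (real K + 1) / 4 \<le> 3 / 4 * B\<^sup>2" by simp
    have "\<epsilon> / (B\<^sup>2 * M $$ (w, w)) * (real K * (real K + 1) / 4) * l1_norm t
       = \<epsilon> / B\<^sup>2 * (real K * (real K + 1) / 4) * Y" by (simp add: Y_def)
    also have "\<dots> \<le> \<epsilon> / B\<^sup>2 * (3 / 4 * B\<^sup>2) * Y"
      using \<epsilon> Y by (intro mult_right_mono mult_left_mono KK) auto
    also have "\<dots> = 3 / 4 * \<epsilon> * Y" using B6 by simp
    finally have "\<bar>rreg s 0 - val_layer K w / (2 * M $$ (w, w))\<bar> \<le> 3 / 4 * \<epsilon> * Y"
      by (rule order_trans[OF conjunct2[OF post[unfolded if_P[OF True]]]])
    moreover have "3 / 4 * \<epsilon> * Y + \<epsilon> / 4 * Y = \<epsilon> * Y" by (simp add: algebra_simps)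
    ultimately show ?thesis using trunc[OF b] by linarith
  next
    case False
    have "\<bar>val_layer K w / (2 * M $$ (w, w))\<bar> = \<bar>val_layer K w\<bar> / (2 * M $$ (w, w))" using d by simp
    also have "\<dots> \<le> (real K * l1_norm t) / (2 * M $$ (w, w))"
      using d by (intro divide_right_mono val_layer_le w) auto
    also have "\<dots> = real K / 2 * Y" by (simp add: Y_def)
    \<comment> \<open>Here \<open>real K \<le> B + 1\<close> and \<open>B \<le> \<epsilon>\<close>,
      and \<epsilon> + 1 is at most 3/2 times \<epsilon> once \<epsilon> is at least 2.\<close>
    also have "\<dots> \<le> 3 / 4 * \<epsilon> * Y" using K False B6 Y by (intro mult_right_mono) auto
    finally have "\<bar>val_layer K w / (2 * M $$ (w, w))\<bar> \<le> 3 / 4 * \<epsilon> * Y" .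
    moreover have "3 / 4 * \<epsilon> * Y + \<epsilon> / 4 * Y = \<epsilon> * Y" by (simp add: algebra_simps)
    moreover have "rreg s 0 = 0" using post False by simp
    ultimately show ?thesis using trunc[OF b] by linarith
  qed
  have time: "real k \<le> 30 + 3 * (Bs ^ 3 / \<epsilon>) + 21 * (Bs\<^sup>2 / \<epsilon>) * cost_layer (nat \<lceil>Bs\<rceil>) w"
  proof (cases "\<epsilon> < B")
    case True
    have "B \<le> Bs ^ 3 / \<epsilon>"
    proof -
      have "1 \<le> B" using B6 by simp
      \<comment> \<open>The branch condition is what absorbs the cost of counting layers into the
        cubic term.\<close>
      hence "1 * \<epsilon> \<le> B * B" using True \<epsilon> by (intro mult_mono) auto
      hence "B * \<epsilon> \<le> B * (B * B)" using B6 by (intro mult_left_mono) auto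
      also have "\<dots> = B ^ 3" by (simp add: power3_eq_cube)
      also have "\<dots> \<le> Bs ^ 3" using BBs B6 by (intro power_mono) auto
      finally show ?thesis using \<epsilon> by (simp add: field_simps)
    qed
    moreover have "21 * (B\<^sup>2 / \<epsilon>) * cost_layer K w \<le> 21 * (Bs\<^sup>2 / \<epsilon>) * cost_layer (nat \<lceil>Bs\<rceil>) w"
    proof (rule mult_mono)
      show "21 * (B\<^sup>2 / \<epsilon>) \<le> 21 * (Bs\<^sup>2 / \<epsilon>)"
        using BBs B6 \<epsilon> by (intro mult_left_mono divide_right_mono power_mono) auto
      show "cost_layer K w \<le> cost_layer (nat \<lceil>Bs\<rceil>) w"
        unfolding K_def using BBs w by (intro layer_sum_mono nat_mono ceiling_mono) auto
    qed (use \<epsilon> cost_layer_nonneg[OF w] in auto)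
    ultimately show ?thesis using post True by simp
  next
    case False
    thus ?thesis using post Bs0 by simp
  qed
  show ?thesis
    unfolding target computes_def using ex acc time by blast
qed

text \<open>45 is 3, for the cubic term of each run, plus 21 times the 2 from rounding
  \<open>Bs\<close> up to an integer.\<close>

lemma average_time_le:
  assumes Bs: "1 \<le> Bs" and \<epsilon>: "0 < \<epsilon>" and n: "0 < n"
    and T: "\<And>w. w < n \<Longrightarrow> real (T w) \<le> 30 + 3 * (Bs ^ 3 / \<epsilon>) + 21 * (Bs\<^sup>2 / \<epsilon>) * cost_layer (nat \<lceil>Bs\<rceil>) w"
  shows "(\<Sum>w<n. real (T w)) / real n \<le> 30 + 45 * (real (nnz M) / real n * Bs ^ 3 / \<epsilon>)"
proof -
  let ?K = "nat \<lceil>Bs\<rceil>"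
  have K: "real ?K \<le> 2 * Bs" using Bs by linarith
  have r: "1 \<le> real (nnz M) / real n" using nnz_ge n by simp
  have "(\<Sum>w<n. real (T w)) \<le> (\<Sum>w<n. 30 + 3 * (Bs ^ 3 / \<epsilon>) + 21 * (Bs\<^sup>2 / \<epsilon>) * cost_layer ?K w)"
    using T by (intro sum_mono) auto
  also have "\<dots> = real n * (30 + 3 * (Bs ^ 3 / \<epsilon>)) + 21 * (Bs\<^sup>2 / \<epsilon>) * (\<Sum>w<n. cost_layer ?K w)"
    by (simp add: sum.distrib sum_distrib_left)
  also have "\<dots> \<le> real n * (30 + 3 * (Bs ^ 3 / \<epsilon>)) + 21 * (Bs\<^sup>2 / \<epsilon>) * (2 * Bs * real (nnz M))"
  proof -
    have "(\<Sum>w<n. cost_layer ?K w) \<le> 2 * Bs * real (nnz M)"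
      using sum_cost_layer[of ?K] mult_right_mono[OF K, of "real (nnz M)"] by linarith
    thus ?thesis using \<epsilon> by (intro add_left_mono mult_left_mono) auto
  qed
  finally have "(\<Sum>w<n. real (T w)) / real n
     \<le> (real n * (30 + 3 * (Bs ^ 3 / \<epsilon>)) + 21 * (Bs\<^sup>2 / \<epsilon>) * (2 * Bs * real (nnz M))) / real n"
    by (intro divide_right_mono) auto
  also have "\<dots> = 30 + 3 * (Bs ^ 3 / \<epsilon>) * 1 + 42 * (real (nnz M) / real n * Bs ^ 3 / \<epsilon>)"
    using n \<epsilon> by (simp add: field_simps power2_eq_square power3_eq_cube)
  also have "3 * (Bs ^ 3 / \<epsilon>) * 1 \<le> 3 * (Bs ^ 3 / \<epsilon>) * (real (nnz M) / real n)"
    using r Bs \<epsilon> by (intro mult_left_mono) auto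
  finally show ?thesis by (simp add: mult_ac)
qed

text \<open>Makes the soft-O form explicit: polynomially bounded entries keep the argument of the
  logarithm polynomial in n, 1 / \<gamma> and 1 / \<epsilon>. The summand 2 puts the argument of the
  final logarithm above e, so constants can be multiplied into it.\<close>

lemma log_argument_le:
  assumes w: "w < n" and \<epsilon>: "0 < \<epsilon>" and \<gamma>: "0 < \<gamma>" and c: "1 \<le> c" and t0: "t \<noteq> 0\<^sub>v n"
    and PM: "poly_entries c a n (elements_mat M)" and Pt: "poly_entries c a n (set\<^sub>v t)"
  shows "log1 (log_argument M (unit_vec n w) t \<gamma> (target_accuracy M (unit_vec n w) t \<epsilon>))
    \<le> (4 * ln c + 4 * real a + 3) * ln (2 + real n + 1 / \<gamma> + 1 / \<epsilon>)"
proof -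
  define Z where "Z = 2 + real n + 1 / \<gamma> + 1 / \<epsilon>"
  have n: "1 \<le> real n" using w by simp
  have Z: "real n \<le> Z" "1 / \<gamma> \<le> Z" "1 / \<epsilon> \<le> Z" "3 \<le> Z"
  proof -
    have "0 < 1 / \<gamma>" "0 < 1 / \<epsilon>" using \<epsilon> \<gamma> by auto
    thus "real n \<le> Z" "1 / \<gamma> \<le> Z" "1 / \<epsilon> \<le> Z" "3 \<le> Z" using n unfolding Z_def by linarith+
  qed
  have "exp 1 \<le> (3::real)" by (rule exp_le)
  hence lnZ: "1 \<le> ln Z" using Z by (subst ln_ge_iff) auto
  define p where "p = c * real n ^ a"
  have p: "1 \<le> p" unfolding p_def using c n by (metis mult_mono' mult_1 one_le_power zero_le_one)
  have entM: "1 / p \<le> M $$ (i, i) \<and> M $$ (i, i) \<le> p" if "i < n" for i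
  proof -
    have "M $$ (i, i) \<in> elements_mat M" using that by (intro elements_matI[OF M]) auto
    thus ?thesis using PM diag[OF that] unfolding poly_entries_def p_def by force
  qed
  have entt: "\<bar>t $ i\<bar> \<le> p \<and> (t $ i \<noteq> 0 \<longrightarrow> 1 / p \<le> \<bar>t $ i\<bar>)" if "i < n" for i
  proof -
    have "t $ i \<in> set\<^sub>v t" using that by (auto simp: vec_setI)
    thus ?thesis using Pt p unfolding poly_entries_def p_def by (cases "t $ i = 0") auto
  qed
  have dm: "0 \<le> d_max M" "d_max M \<le> p"
    using diag_le_d_max[OF M w] diag[OF w] apply simp
    unfolding d_max_def using entM w by (subst Max_le_iff) (auto simp: lessThan_empty_iff)
  have l0: "real (l0_norm t) \<le> real n"
  proof -
    have "l0_norm t \<le> card {..<n}" unfolding l0_norm_def by (intro card_mono) auto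
    thus ?thesis by simp
  qed
  have Dt: "dim_vec (D_pow M (-1) *\<^sub>v t) = n" using D_pow_carrier[OF M, of "-1"] by auto
  have linf: "linf_norm (D_pow M (-1) *\<^sub>v t) \<le> p * p"
  proof (rule linf_norm_le)
    fix i assume "i < dim_vec (D_pow M (-1) *\<^sub>v t)"
    hence i: "i < n" using Dt by simp
    have "\<bar>(D_pow M (-1) *\<^sub>v t) $ i\<bar> = 1 / M $$ (i, i) * \<bar>t $ i\<bar>"
      using D_pow_mult_vec[OF M t i, of "-1"] diag[OF i] by (simp add: powr_minus abs_mult divide_inverse)
    also have "\<dots> \<le> p * p"
    proof (rule mult_mono)
      show "1 / M $$ (i, i) \<le> p" using entM[OF i] diag[OF i] p by (simp add: field_simps)
    qed (use entt[OF i] p in auto)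
    finally show "\<bar>(D_pow M (-1) *\<^sub>v t) $ i\<bar> \<le> p * p" .
  qed (use Dt w in simp)
  have linf0: "0 \<le> linf_norm (D_pow M (-1) *\<^sub>v t)" using linf_norm_ge[of w "D_pow M (-1) *\<^sub>v t"] Dt w by linarith
  have l1: "1 / p \<le> l1_norm t"
  proof -
    obtain i where i: "i < n" "t $ i \<noteq> 0" using t t0 by (metis carrier_vecD dim_vec index_zero_vec eq_vecI)
    hence "\<bar>t $ i\<bar> \<le> l1_norm t" unfolding l1_norm_def by (intro member_le_sum) auto
    thus ?thesis using entt i by force
  qed
  define X where "X = d_max M * real (l0_norm t) * linf_norm (D_pow M (-1) *\<^sub>v t) / (\<gamma> * \<epsilon> * l1_norm t)"
  have l1p: "0 < l1_norm t" by (rule l1_norm_pos[OF t0])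
  have "X = (1 / \<gamma>) * (1 / \<epsilon>) * (1 / l1_norm t) * (d_max M * real (l0_norm t) * linf_norm (D_pow M (-1) *\<^sub>v t))"
    by (simp add: X_def)
  also have "\<dots> \<le> Z * Z * p * (p * real n * (p * p))"
  proof (intro mult_mono)
    show "1 / l1_norm t \<le> p" using l1 l1p p by (simp add: field_simps)
  qed (use Z dm l0 linf linf0 p l1p \<epsilon> \<gamma> in auto)
  \<comment> \<open>The four factors \<open>p\<close> come from \<open>l1_norm t\<close>,
    \<open>d_max M\<close> and the two bounds in the sup norm; the three factors that are at most
    \<open>Z\<close> are 1 / \<gamma>, 1 / \<epsilon> and n.\<close>
  also have "\<dots> = p ^ 4 * (real n * Z ^ 2)" by (simp add: power2_eq_square power4_eq_xxxx)
  also have "\<dots> \<le> (c * Z ^ a) ^ 4 * (Z * Z ^ 2)"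
    unfolding p_def using Z c n by (intro mult_mono power_mono mult_left_mono) auto
  also have "\<dots> = c ^ 4 * Z ^ (4 * a + 3)"
    by (simp add: power_mult_distrib power_add power_mult[symmetric] power2_eq_square power3_eq_cube mult.commute[of a])
  finally have XZ: "X \<le> c ^ 4 * Z ^ (4 * a + 3)" .
  have lnc: "0 \<le> ln c" using c by simp
  have "1 * 1 \<le> (4 * ln c + 4 * real a + 3) * ln Z" using lnc lnZ by (intro mult_mono) auto
  hence one_le: "1 \<le> (4 * ln c + 4 * real a + 3) * ln Z" by simp
  moreover have "ln X \<le> (4 * ln c + 4 * real a + 3) * ln Z"
  proof (cases "0 < X")
    case True
    have "ln X \<le> ln (c ^ 4 * Z ^ (4 * a + 3))" using XZ True by simp
    also have "\<dots> = 4 * ln c + (4 * real a + 3) * ln Z" using c Z by (simp add: ln_mult ln_realpow)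
    also have "\<dots> \<le> 4 * ln c * ln Z + (4 * real a + 3) * ln Z"
      using lnc lnZ mult_left_mono[OF lnZ, of "4 * ln c"] by simp
    finally show ?thesis by (simp add: algebra_simps)
  next
    case False
    moreover have "0 \<le> X" unfolding X_def using dm linf0 \<epsilon> \<gamma> l1p by (intro divide_nonneg_pos mult_nonneg_nonneg) auto
    ultimately have "X = 0" by simp
    thus ?thesis using one_le by simp
  qed
  ultimately show ?thesis
    unfolding log_argument_unit_vec[OF w] X_def[symmetric] Z_def[symmetric] log1_def by simp
qed

end

text \<open>The program is chosen before \<open>\<kappa>\<close>, which it cannot know; only the
  constants depend on the quality of the given \<open>\<Lambda>\<close>.\<close>

theorem theorem6p6:
  shows "\<exists>P :: com. \<forall>\<kappa>::real. \<exists>C>0::real. \<forall>(c::real) (a::nat). c \<ge> 1 \<longrightarrow> (\<exists>C'>0::real. \<exists>k::nat.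
    \<forall>(n::nat) (M::real mat) (t::real vec) rlist clist (\<epsilon>::real) (\<gamma>::real) (\<Lambda>::nat \<Rightarrow> real).
      M \<in> carrier_mat n n \<longrightarrow> t \<in> carrier_vec n \<longrightarrow> t \<noteq> 0\<^sub>v n \<longrightarrow> rdd M \<longrightarrow>
      poly_entries c a n (elements_mat M) \<longrightarrow> poly_entries c a n (set\<^sub>v t) \<longrightarrow>
      lists_nonzeros M rlist clist \<longrightarrow>
      0 < \<epsilon> \<longrightarrow> 0 < \<gamma> \<longrightarrow> \<gamma> \<le> gamma_max M \<longrightarrow>
      (\<forall>w<n. suitable_bound \<kappa> M (unit_vec n w) t \<gamma> \<epsilon> (\<Lambda> w)) \<longrightarrow>
      (\<exists>(T :: nat \<Rightarrow> nat) (xhat :: nat \<Rightarrow> real).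
        (\<forall>w<n. computes P
           \<lparr>acc_mat = M, acc_b = unit_vec n w, acc_t = t, acc_rows = rlist, acc_cols = clist\<rparr>
           (input_state n w \<epsilon> \<gamma> (\<Lambda> w)) (T w) (xhat w)) \<and>
        (\<forall>w<n. unit_vec n w \<in> mat_range M \<longrightarrow>
           \<bar>xhat w - t \<bullet> x_star M (unit_vec n w)\<bar>
             \<le> \<epsilon> * l1_norm t * linf_norm (D_pow M (-1) *\<^sub>v unit_vec n w)) \<and>
        (\<forall>v<n. (\<Sum>w<n. real (T w)) / real n
           \<le> C * max 1 (real (nnz M) / real n * L_param M (unit_vec n v) t \<gamma> \<epsilon> ^ 3 / \<epsilon>)) \<and>
        (\<Sum>w<n. real (T w)) / real n
           \<le> C' * max 1 (real (nnz M) / real n * (1 / \<gamma>) ^ 3 / \<epsilon>)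
               * ln (2 + real n + 1 / \<gamma> + 1 / \<epsilon>) ^ k))"
proof (rule exI[of _ solver], rule allI, goal_cases)
  case (1 \<kappa>)
  \<comment> \<open>From \<open>average_time_le\<close> with \<open>Bs = 6 * \<kappa> * L\<close>.
    The absolute value keeps the constant positive for every real \<open>\<kappa>\<close>.\<close>
  define C where "C = 30 + 45 * (6 * \<bar>\<kappa>\<bar>) ^ 3"
  have C0: "0 < C" by (auto simp: C_def intro!: add_pos_nonneg)
  show ?case
  proof (rule exI[of _ C], rule conjI[OF C0], intro allI impI, goal_cases)
    case (1 c a)
    note c = this
    \<comment> \<open>Coefficient from \<open>log_argument_le\<close>; since L enters cubed, it
      reappears cubed in the constant, and the power of the logarithm is 3.\<close>
    define c' where "c' = 4 * ln c + 4 * real a + 3"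
    have c'3: "3 \<le> c'" using c by (simp add: c'_def)
    have C'0: "0 < C * c' ^ 3" using C0 c'3 by simp
    show ?case
    proof (rule exI[of _ "C * c' ^ 3"], rule conjI[OF C'0], rule exI[of _ 3], intro allI impI, goal_cases)
      case (1 n M t rlist clist \<epsilon> \<gamma> \<Lambda>)
      note M = 1(1) and t = 1(2) and t0 = 1(3) and rdd = 1(4) and PM = 1(5) and Pt = 1(6)
        and lists = 1(7) and \<epsilon> = 1(8) and \<gamma> = 1(9,10) and \<Lambda> = 1(11)
      define A where "A w = \<lparr>acc_mat = M, acc_b = unit_vec n w, acc_t = t, acc_rows = rlist, acc_cols = clist\<rparr>" for w
      have input: "push_input (A w) n M t" for w
        using M t rdd lists by unfold_locales (auto simp: A_def lists_nonzeros_def)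
      have n: "0 < n" using t t0 by (cases n) auto
      interpret P0: push_input "A 0" n M t by (rule input)
      define L where "L = L_param M (unit_vec n 0) t \<gamma> \<epsilon>"
      have L: "L_param M (unit_vec n v) t \<gamma> \<epsilon> = L" if "v < n" for v
        unfolding L_def L_param_unit_vec[OF M rdd that] L_param_unit_vec[OF M rdd n] ..
      define Bs where "Bs = 6 * \<kappa> * L"
      have Bs: "6 * log1 (\<Lambda> w) / \<gamma> \<le> Bs"
        and \<Lambda>w: "log_argument M (unit_vec n w) t \<gamma> (target_accuracy M (unit_vec n w) t \<epsilon>) \<le> \<Lambda> w" if "w < n" for w
      proof -
        let ?X = "log_argument M (unit_vec n w) t \<gamma> (target_accuracy M (unit_vec n w) t \<epsilon>)"
        have sb: "?X \<le> \<Lambda> w" "log1 (\<Lambda> w) \<le> \<kappa> * log1 ?X"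
          using \<Lambda> that by (auto simp: suitable_bound_def Let_def)
        show "?X \<le> \<Lambda> w" by fact
        have "6 * log1 (\<Lambda> w) / \<gamma> \<le> 6 * (\<kappa> * log1 ?X) / \<gamma>"
          using sb \<gamma> by (intro divide_right_mono mult_left_mono) auto
        also have "\<dots> = 6 * \<kappa> * L_param M (unit_vec n w) t \<gamma> \<epsilon>" by (simp add: L_param_def)
        finally show "6 * log1 (\<Lambda> w) / \<gamma> \<le> Bs" by (simp add: Bs_def L[OF that])
      qed
      \<comment> \<open>The inputs \<open>A w\<close> differ only in the right-hand side, so all of
        them share the cost layers of \<open>A 0\<close>.\<close>
      have "\<exists>k y. computes solver (A w) (input_state n w \<epsilon> \<gamma> (\<Lambda> w)) k y
        \<and> (unit_vec n w \<in> mat_range M \<longrightarrow> \<bar>y - t \<bullet> x_star M (unit_vec n w)\<bar> 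
            \<le> \<epsilon> * l1_norm t * linf_norm (D_pow M (-1) *\<^sub>v unit_vec n w))
        \<and> real k \<le> 30 + 3 * (Bs ^ 3 / \<epsilon>) + 21 * (Bs\<^sup>2 / \<epsilon>) * P0.cost_layer (nat \<lceil>Bs\<rceil>) w" if "w < n" for w
        using push_input.solver_correct[OF input that \<gamma> \<epsilon> t0 \<Lambda>w[OF that] Bs[OF that]]
        by (simp add: A_def)
      then obtain T xhat where TX: "\<And>w. w < n \<Longrightarrow> computes solver (A w) (input_state n w \<epsilon> \<gamma> (\<Lambda> w)) (T w) (xhat w)
        \<and> (unit_vec n w \<in> mat_range M \<longrightarrow> \<bar>xhat w - t \<bullet> x_star M (unit_vec n w)\<bar> 
            \<le> \<epsilon> * l1_norm t * linf_norm (D_pow M (-1) *\<^sub>v unit_vec n w))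
        \<and> real (T w) \<le> 30 + 3 * (Bs ^ 3 / \<epsilon>) + 21 * (Bs\<^sup>2 / \<epsilon>) * P0.cost_layer (nat \<lceil>Bs\<rceil>) w"
        by metis
      have \<gamma>1: "\<gamma> \<le> 1" using \<gamma> gamma_max_le_1[OF M n] by simp
      have "6 * 1 / 1 \<le> 6 * log1 (\<Lambda> 0) / \<gamma>" using \<gamma> \<gamma>1 by (intro frac_le mult_left_mono) (auto simp: log1_def)
      hence Bs1: "1 \<le> Bs" using Bs[OF n] by simp
      have L0: "0 < L" using \<gamma> by (auto simp: L_def L_param_def log1_def)
      define R where "R = real (nnz M) / real n"
      have R0: "0 \<le> R" by (simp add: R_def)
      define avg where "avg = (\<Sum>w<n. real (T w)) / real n"
      have "avg \<le> 30 + 45 * (R * Bs ^ 3 / \<epsilon>)"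
        unfolding avg_def R_def using TX by (intro P0.average_time_le[OF Bs1 \<epsilon> n]) auto
      also have "\<dots> \<le> 30 + 45 * (R * (6 * \<bar>\<kappa>\<bar> * L) ^ 3 / \<epsilon>)"
      proof -
        have "Bs \<le> 6 * \<bar>\<kappa>\<bar> * L" unfolding Bs_def using L0 by (intro mult_right_mono) auto
        thus ?thesis using R0 \<epsilon> Bs1
          by (intro add_left_mono mult_left_mono divide_right_mono power_mono) auto
      qed
      also have "\<dots> = 30 * 1 + 45 * (6 * \<bar>\<kappa>\<bar>) ^ 3 * (R * L ^ 3 / \<epsilon>)"
        by (simp add: power_mult_distrib)
      also have "\<dots> \<le> 30 * max 1 (R * L ^ 3 / \<epsilon>) + 45 * (6 * \<bar>\<kappa>\<bar>) ^ 3 * max 1 (R * L ^ 3 / \<epsilon>)"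
        by (intro add_mono mult_left_mono) auto
      finally have avg: "avg \<le> C * max 1 (R * L ^ 3 / \<epsilon>)" by (simp add: C_def distrib_right)
      define Z where "Z = ln (2 + real n + 1 / \<gamma> + 1 / \<epsilon>)"
      have LZ: "L \<le> 1 / \<gamma> * (c' * Z)"
        unfolding L_def L_param_def c'_def Z_def using \<gamma>
        by (intro mult_left_mono P0.log_argument_le n \<epsilon> c t0 PM Pt) auto
      have cZ: "1 \<le> c' * Z"
      proof -
        have "1 \<le> log1 (log_argument M (unit_vec n 0) t \<gamma> (target_accuracy M (unit_vec n 0) t \<epsilon>))"
          by (simp add: log1_def)
        also have "\<dots> \<le> c' * Z" unfolding c'_def Z_def by (intro P0.log_argument_le n \<epsilon> \<gamma> c t0 PM Pt)
        finally show ?thesis .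
      qed
      have "R * L ^ 3 / \<epsilon> \<le> R * (1 / \<gamma> * (c' * Z)) ^ 3 / \<epsilon>"
        using R0 \<epsilon> L0 LZ by (intro divide_right_mono mult_left_mono power_mono) auto
      also have "\<dots> = (R * (1 / \<gamma>) ^ 3 / \<epsilon>) * (c' * Z) ^ 3" by (simp add: power_mult_distrib power_divide)
      also have "\<dots> \<le> max 1 (R * (1 / \<gamma>) ^ 3 / \<epsilon>) * (c' * Z) ^ 3"
        using cZ by (intro mult_right_mono) auto
      finally have RL: "R * L ^ 3 / \<epsilon> \<le> max 1 (R * (1 / \<gamma>) ^ 3 / \<epsilon>) * (c' * Z) ^ 3" .
      have "1 * 1 \<le> max 1 (R * (1 / \<gamma>) ^ 3 / \<epsilon>) * (c' * Z) ^ 3"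
        using cZ by (intro mult_mono one_le_power) auto
      with RL have "max 1 (R * L ^ 3 / \<epsilon>) \<le> max 1 (R * (1 / \<gamma>) ^ 3 / \<epsilon>) * (c' * Z) ^ 3" by simp
      hence "C * max 1 (R * L ^ 3 / \<epsilon>) \<le> C * (max 1 (R * (1 / \<gamma>) ^ 3 / \<epsilon>) * (c' * Z) ^ 3)"
        using C0 by (intro mult_left_mono) auto
      with avg have "avg \<le> C * (max 1 (R * (1 / \<gamma>) ^ 3 / \<epsilon>) * (c' * Z) ^ 3)" by linarith
      hence avg': "avg \<le> C * c' ^ 3 * max 1 (R * (1 / \<gamma>) ^ 3 / \<epsilon>) * Z ^ 3"
        by (simp only: power_mult_distrib mult_ac)
      show ?case
      proof (intro exI[of _ T] exI[of _ xhat] conjI allI impI)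
        fix v assume "v < n"
        from L[OF this] avg show "(\<Sum>w<n. real (T w)) / real n
           \<le> C * max 1 (real (nnz M) / real n * L_param M (unit_vec n v) t \<gamma> \<epsilon> ^ 3 / \<epsilon>)"
          by (simp only: avg_def R_def)
      next
        show "(\<Sum>w<n. real (T w)) / real n
           \<le> C * c' ^ 3 * max 1 (real (nnz M) / real n * (1 / \<gamma>) ^ 3 / \<epsilon>)
               * ln (2 + real n + 1 / \<gamma> + 1 / \<epsilon>) ^ 3"
          using avg' by (simp only: avg_def R_def Z_def)
      qed (use TX in \<open>auto simp: A_def\<close>)
    qed
  qed
qed

end
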